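(* Let $W$ be a piecewise $c$-Lipschitz graphon. Let $\hat P$ be an estimator of the edge probability matrix which is consistent in max-norm for $W$, i.e. for every $\epsilon>0$, $\lim_{n\to\infty}\Pr\big(\max_{i\neq j}|P_{ij}-\hat P_{ij}|>\epsilon\big)=0$. Let $f$ be the clustering method which maps a graph $G$ to the single-linkage clustering of its node set using $\hat P=\hat P(G)$ as a similarity matrix. Then $f$ is a consistent estimator of the graphon cluster tree of $W$.
   Context: Graphons and clusters. $\mu$ is Lebesgue measure on $[0,1]$ and $\Sigma$ the Lebesgue measurable subsets. A graphon is a symmetric measurable $W:[0,1]^2\to[0,1]$. A measurable $A\subset[0,1]$ with $\mu(A)>0$ is disconnected at level $\lambda$ in $W$ if there is a measurable $S\subset A$ with $0<\mu(S)<\mu(A)$ and $W<\lambda$ a.e. on $S\times(A\setminus S)$; otherwise $A$ is connected at level $\lambda$. Let $\mathfrak A_\lambda$ be the collection of $A\in\Sigma$ with $\mu(A)>0$ that are connected at every level $\lambda'<\lambda$. For $A_1,A_2\in\mathfrak A_\lambda$ write $A_1\sim_\lambda A_2$ iff some $A\in\mathfrak A_\lambda$ has $A\supset A_1\cup A_2$; this is an equivalence relation. For each equivalence class $\mathscr A$, the essential maxima are the $A^*\in\mathscr A$ with $\mu(A\setminus A^* )=0$ for all $A\in\mathscr A$; they exist and are unique up to null sets. The clusters of $W$ at level $\lambda$ are the classes of measurable sets modulo null sets $\mathcal C=\operatorname{ess\,max}\mathscr A$; $\mathbb C_W(\lambda)$ is the (countable) collection of them, and the family $\mathbb C_W$ is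 the graphon cluster tree of $W$. Mergeon. A mergeon of $W$ (of $\mathbb C_W$) is a graphon $M$ such that for every $\lambda\in[0,1]$, $\{(x,y):M(x,y)\ge\lambda\}$ equals $\bigcup_{\mathcal C\in\mathbb C_W(\lambda)}\mathcal C\times\mathcal C$ up to a null set. Any two mergeons of $W$ agree a.e. Clusterings and merge distortion. A clustering of a finite set $S$ is a collection $\mathsf C$ of subsets of $S$ with $S\in\mathsf C$ such that any two members are nested or disjoint. For $S\subset[0,1]$ finite, a clustering $\mathsf C$ of $S$ and a mergeon $M$, the induced merge height is $\hat M_{\mathsf C}(s,s')=\min\{M(u,v):u,v\in \mathsf C(s,s'),\,u\ne v\}$ for $s\neq s'$, where $\mathsf C(s,s')$ is the smallest member of $\mathsf C$ containing $s$ and $s'$. The merge distortion is $d_S(M,\hat M_{\mathsf C})=\max_{s\ne s'\in S}|M(s,s')-\hat M_{\mathsf C}(s,s')|$. Label measure and consistency. Let $\mathcal G_n$ be the set of simple undirected graphs on $[n]=\{1,\dots,n\}$. $\Lambda_{W,n}$ is the probability measure on $\mathcal G_n\times[0,1]^n$ with $\Lambda_{W,n}(\mathcal G\times\mathcal S)=\sum_{G\in\mathcal G}\int_{\mathcal S}\prod_{\{i,j\}\in E(G)}W(x_i,x_j)\prod_{\{i,j\}\notin E(G)}[1-W(x_i,x_j)]\,dx_1\cdots dx_n$ (products over unordered pairs $i\ne j$): the joint law of i.i.d. uniform labels $S=(x_1,\dots,x_n)$ and the graph $G$ sampled given them. A hierarchical graph clustering method $f$ assigns to every $G\in\mathcal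 G_n$ (every $n$) a clustering of $[n]$; $f(G)\circ S$ is the clustering of $S$ obtained by replacing $i$ by $x_i$. $f$ is a consistent estimator of the graphon cluster tree of $W$ if, for every mergeon $M$ of $W$ and every $\epsilon>0$, $\Lambda_{W,n}\big(\{(G,S):d_S(M,\hat M_{f(G)\circ S})>\epsilon\}\big)\to0$ as $n\to\infty$. Piecewise Lipschitz. $W$ is piecewise $c$-Lipschitz if there is a finite partition $\mathcal B=\{B_1,\dots,B_k\}$ of $[0,1]$ into disjoint (open, half-open or closed) intervals of positive length such that $|W(x,y)-W(x',y')|\le c(|x-x'|+|y-y'|)$ for all $(x,y),(x',y')\in B_i\times B_j$ and all $i,j$. Edge probabilities and single linkage. $P$ is the $n\times n$ matrix $P_{ij}=W(x_i,x_j)$. An estimator $\hat P$ assigns to each $G\in\mathcal G_n$ (every $n$) a symmetric real $n\times n$ matrix; $\Pr$ is with respect to $\Lambda_{W,n}$. The single-linkage clustering of $[n]$ with similarity matrix $\hat P$ is the set of all connected components, over all $\lambda\in\mathbb R$, of the graph on $[n]$ joining $i\neq j$ whenever $\hat P_{ij}\ge\lambda$. *)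

theory Defs
  imports "HOL-Probability.Probability"
begin

section \<open>Graphons\<close>

abbreviation unit_leb :: "real measure" where
  "unit_leb \<equiv> lebesgue_on {0..1}"

abbreviation square_leb :: "(real \<times> real) measure" where
  "square_leb \<equiv> lebesgue_on ({0..1} \<times> {0..1})"

text \<open>All functions on the unit square are total functions on the plane; nothing below depends on
  their values outside the unit square.\<close>

definition graphon :: "(real \<Rightarrow> real \<Rightarrow> real) \<Rightarrow> bool" where
  "graphon W \<longleftrightarrow>
     (\<forall>x\<in>{0..1}. \<forall>y\<in>{0..1}. W x y \<in> {0..1} \<and> W x y = W y x) \<and>
     (\<lambda>(x, y). W x y) \<in> borel_measurable square_leb"

definition piecewise_lipschitz :: "real \<Rightarrow> (real \<Rightarrow> real \<Rightarrow> real) \<Rightarrow> bool" where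
  "piecewise_lipschitz c W \<longleftrightarrow>
     (\<exists>\<B>. finite \<B> \<and> partition_on {0..1} \<B> \<and>
        (\<forall>B\<in>\<B>. is_interval B \<and> measure lebesgue B > 0) \<and>
        (\<forall>B\<in>\<B>. \<forall>B'\<in>\<B>. \<forall>x\<in>B. \<forall>x'\<in>B. \<forall>y\<in>B'. \<forall>y'\<in>B'.
           \<bar>W x y - W x' y'\<bar> \<le> c * (\<bar>x - x'\<bar> + \<bar>y - y'\<bar>)))"

section \<open>The graphon cluster tree and mergeons\<close>

definition disconnected_at :: "(real \<Rightarrow> real \<Rightarrow> real) \<Rightarrow> real \<Rightarrow> real set \<Rightarrow> bool" where
  "disconnected_at W l A \<longleftrightarrow>
     (\<exists>S\<in>sets unit_leb. S \<subseteq> A \<and> 0 < measure unit_leb S \<and> measure unit_leb S < measure unit_leb A \<and>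
        (AE (x, y) in square_leb. x \<in> S \<and> y \<in> A - S \<longrightarrow> W x y < l))"

definition connected_sets :: "(real \<Rightarrow> real \<Rightarrow> real) \<Rightarrow> real \<Rightarrow> real set set" where
  "connected_sets W l =
     {A \<in> sets unit_leb. measure unit_leb A > 0 \<and> (\<forall>l'<l. \<not> disconnected_at W l' A)}"

definition cluster_rel :: "(real \<Rightarrow> real \<Rightarrow> real) \<Rightarrow> real \<Rightarrow> (real set \<times> real set) set" where
  "cluster_rel W l =
     {(A1, A2). A1 \<in> connected_sets W l \<and> A2 \<in> connected_sets W l \<and>
        (\<exists>A\<in>connected_sets W l. A1 \<union> A2 \<subseteq> A)}"

definition ess_max :: "real set set \<Rightarrow> real set set" where
  "ess_max \<A> = {A' \<in> \<A>. \<forall>A\<in>\<A>. measure unit_leb (A - A') = 0}"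

text \<open>A cluster is a class of measurable sets modulo null sets, represented by the set of all its
  members.\<close>

definition clusters :: "(real \<Rightarrow> real \<Rightarrow> real) \<Rightarrow> real \<Rightarrow> real set set set" where
  "clusters W l = ess_max ` (connected_sets W l // cluster_rel W l)"

text \<open>Here \<open>r\<close> picks a representative set of each cluster. There are only countably many clusters
  at each level, so up to a null set the union does not depend on the choice.\<close>

definition mergeon :: "(real \<Rightarrow> real \<Rightarrow> real) \<Rightarrow> (real \<Rightarrow> real \<Rightarrow> real) \<Rightarrow> bool" where
  "mergeon W M \<longleftrightarrow> graphon M \<and>
     (\<forall>l\<in>{0..1}. \<exists>r. (\<forall>C\<in>clusters W l. r C \<in> C) \<and>
        (AE (x, y) in square_leb. M x y \<ge> l \<longleftrightarrow> (x, y) \<in> (\<Union>C\<in>clusters W l. r C \<times> r C)))"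

section \<open>Clusterings and merge distortion\<close>

definition clustering :: "'a set \<Rightarrow> 'a set set \<Rightarrow> bool" where
  "clustering S \<C> \<longleftrightarrow> \<C> \<subseteq> Pow S \<and> S \<in> \<C> \<and>
     (\<forall>A\<in>\<C>. \<forall>B\<in>\<C>. A \<subseteq> B \<or> B \<subseteq> A \<or> A \<inter> B = {})"

definition smallest_cluster :: "'a set set \<Rightarrow> 'a \<Rightarrow> 'a \<Rightarrow> 'a set" where
  "smallest_cluster \<C> s s' = (LEAST C. C \<in> \<C> \<and> s \<in> C \<and> s' \<in> C)"

definition induced_merge_height ::
    "(real \<Rightarrow> real \<Rightarrow> real) \<Rightarrow> real set set \<Rightarrow> real \<Rightarrow> real \<Rightarrow> real" where
  "induced_merge_height M \<C> s s' =
     Min {M u v | u v. u \<in> smallest_cluster \<C> s s' \<and> v \<in> smallest_cluster \<C> s s' \<and> u \<noteq> v}"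

text \<open>The inserted 0 only matters when \<open>S\<close> has fewer than two elements.\<close>

definition merge_distortion ::
    "real set \<Rightarrow> (real \<Rightarrow> real \<Rightarrow> real) \<Rightarrow> (real \<Rightarrow> real \<Rightarrow> real) \<Rightarrow> real" where
  "merge_distortion S M M' =
     Max (insert 0 {\<bar>M s s' - M' s s'\<bar> | s s'. s \<in> S \<and> s' \<in> S \<and> s \<noteq> s'})"

section \<open>Sampled graphs and consistency\<close>

text \<open>A simple graph on \<open>{1..n}\<close> is represented by its set of edges.\<close>

definition graphs :: "nat \<Rightarrow> nat set set set" where
  "graphs n = Pow {e. e \<subseteq> {1..n} \<and> card e = 2}"

definition graph_likelihood ::
    "(real \<Rightarrow> real \<Rightarrow> real) \<Rightarrow> nat \<Rightarrow> nat set set \<Rightarrow> (nat \<Rightarrow> real) \<Rightarrow> real" where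
  "graph_likelihood W n G x =
     (\<Prod>(i, j) \<in> {(i, j). i \<in> {1..n} \<and> j \<in> {1..n} \<and> i < j}.
        if {i, j} \<in> G then W (x i) (x j) else 1 - W (x i) (x j))"

text \<open>The labels carry the completed product measure, i.e. Lebesgue measure on the \<open>n\<close>-cube: for a
  graphon that is merely Lebesgue measurable, \<open>x \<mapsto> W (x i) (x j)\<close> need not be measurable for the
  uncompleted product sigma-algebra.\<close>

definition label_measure ::
    "(real \<Rightarrow> real \<Rightarrow> real) \<Rightarrow> nat \<Rightarrow> (nat set set \<times> (nat \<Rightarrow> real)) measure" where
  "label_measure W n =
     density (count_space (graphs n) \<Otimes>\<^sub>M completion (\<Pi>\<^sub>M i\<in>{1..n}. unit_leb))
       (\<lambda>(G, x). ennreal (graph_likelihood W n G x))"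

text \<open>A function of the graph takes the number of nodes as an additional argument, because the edge
  set does not determine it.\<close>

definition clustering_method :: "(nat \<Rightarrow> nat set set \<Rightarrow> nat set set) \<Rightarrow> bool" where
  "clustering_method f \<longleftrightarrow> (\<forall>n\<ge>1. \<forall>G\<in>graphs n. clustering {1..n} (f n G))"

definition relabel :: "nat set set \<Rightarrow> (nat \<Rightarrow> real) \<Rightarrow> real set set" where
  "relabel \<C> x = (\<lambda>C. x ` C) ` \<C>"

definition distortion_event ::
    "(real \<Rightarrow> real \<Rightarrow> real) \<Rightarrow> (real \<Rightarrow> real \<Rightarrow> real) \<Rightarrow> (nat \<Rightarrow> nat set set \<Rightarrow> nat set set) \<Rightarrow>
     nat \<Rightarrow> real \<Rightarrow> (nat set set \<times> (nat \<Rightarrow> real)) set" where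
  "distortion_event W M f n \<epsilon> =
     {(G, x) \<in> space (label_measure W n).
        merge_distortion (x ` {1..n}) M (induced_merge_height M (relabel (f n G) x)) > \<epsilon>}"

text \<open>Measurability is stated explicitly because \<open>measure\<close> is 0 on non-measurable sets.\<close>

definition consistent_cluster_tree_estimator ::
    "(real \<Rightarrow> real \<Rightarrow> real) \<Rightarrow> (nat \<Rightarrow> nat set set \<Rightarrow> nat set set) \<Rightarrow> bool" where
  "consistent_cluster_tree_estimator W f \<longleftrightarrow> clustering_method f \<and>
     (\<forall>M. mergeon W M \<longrightarrow> (\<forall>\<epsilon>>0.
        (\<forall>n. distortion_event W M f n \<epsilon> \<in> sets (label_measure W n)) \<and>
        (\<lambda>n. measure (label_measure W n) (distortion_event W M f n \<epsilon>)) \<longlonglongrightarrow> 0))"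

section \<open>Edge probability estimators and single linkage\<close>

definition matrix_estimator :: "(nat \<Rightarrow> nat set set \<Rightarrow> nat \<Rightarrow> nat \<Rightarrow> real) \<Rightarrow> bool" where
  "matrix_estimator P \<longleftrightarrow>
     (\<forall>n. \<forall>G\<in>graphs n. \<forall>i\<in>{1..n}. \<forall>j\<in>{1..n}. P n G i j = P n G j i)"

text \<open>For a graphon \<open>W\<close> the event below is always measurable. The inserted 0 only matters for
  \<open>n \<le> 1\<close>.\<close>

definition max_norm_consistent ::
    "(real \<Rightarrow> real \<Rightarrow> real) \<Rightarrow> (nat \<Rightarrow> nat set set \<Rightarrow> nat \<Rightarrow> nat \<Rightarrow> real) \<Rightarrow> bool" where
  "max_norm_consistent W P \<longleftrightarrow>
     (\<forall>\<epsilon>>0. (\<lambda>n. measure (label_measure W n)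
        {(G, x) \<in> space (label_measure W n).
           Max (insert 0 {\<bar>W (x i) (x j) - P n G i j\<bar> | i j.
             i \<in> {1..n} \<and> j \<in> {1..n} \<and> i \<noteq> j}) > \<epsilon>}) \<longlonglongrightarrow> 0)"

definition threshold_edges :: "nat \<Rightarrow> (nat \<Rightarrow> nat \<Rightarrow> real) \<Rightarrow> real \<Rightarrow> (nat \<times> nat) set" where
  "threshold_edges n P l = {(i, j). i \<in> {1..n} \<and> j \<in> {1..n} \<and> i \<noteq> j \<and> P i j \<ge> l}"

text \<open>Since \<open>P\<close> is symmetric, the classes of the reflexive transitive closure are the connected
  components of the threshold graph.\<close>

definition single_linkage :: "nat \<Rightarrow> (nat \<Rightarrow> nat \<Rightarrow> real) \<Rightarrow> nat set set" where
  "single_linkage n P = (\<Union>l. {1..n} // (threshold_edges n P l)\<^sup>*)"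

end

theory Submission
  imports Defs
begin

text \<open>For \<open>d > 0\<close>, split the unit interval, up to a null set, into finitely many parts \<open>Q\<close> of positive
  measure such that \<open>W\<close> varies by at most \<open>d\<close> on each product of two parts. If two parts are joined
  by a path of parts on whose successive products \<open>W\<close> is at least \<open>l\<close>, then the union of a component
  of such parts is connected at every level below \<open>l\<close>, so that the mergeon is at least \<open>l\<close> almost
  everywhere on the product of the two parts. Conversely, two parts which meet the same
  connected set at level \<open>l\<close> in positive measure are joined by a path on whose products \<open>W\<close> reaches
  every given level below \<open>l\<close>. With high probability every part contains a label and the estimate of the
  edge probabilities is \<open>d\<close>-accurate. Then paths of parts and paths in the threshold graphs of the
  estimate translate into each other at the cost of a multiple of \<open>d\<close>, so that the mergeon agrees with
  the single-linkage merge height up to a multiple of \<open>d\<close> for every pair of labels.\<close>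

section \<open>Null sets of the unit square and the joint law of two labels\<close>

section \<open>Independent uniform labels\<close>

text \<open>A mergeon is fixed only almost everywhere, with an exceptional set for every level,
  whereas the distortion evaluates it at sampled points. Randomness of the labels resolves this: two
  distinct labels have a joint density, so any countable family of null sets of the square is
  avoided almost surely.

  Paths of parts have to be nonempty. If a part has no neighbour at some level, not even itself,
  then any small piece of it can be split off, so no set connected at that level meets it in
  positive measure.

  The final factor is 7: passing from a mergeon value to a threshold path costs
  \<open>4 * d\<close>, and passing back to the mergeon value of another pair in the same cluster
  costs \<open>3 * d\<close>.

  Regularity of \<open>W\<close> enters only through the partition; that it is finite with parts of
  positive measure is what makes labels hit all parts.\<close>

lemma prob_space_unit_leb: "prob_space unit_leb"
  by standard (simp add: emeasure_restrict_space)

lemma prob_space_labels: "prob_space (completion (\<Pi>\<^sub>M i\<in>I. unit_leb))"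
  by (intro prob_space.prob_space_completion prob_space_PiM prob_space_unit_leb)

text \<open>Lebesgue measure on the plane is the completion of a product measure rather than a
  product itself. Completion preserves statements valid almost everywhere, so Fubini arguments can
  be run for \<open>lborel\<close>.\<close>

lemma AE_square_leb_iff:
  "(AE p in square_leb. P p) \<longleftrightarrow> (AE p in lborel. p \<in> {0..1} \<times> {0..1} \<longrightarrow> P p)"
proof -
  have "({0..1} \<times> {0..1} :: (real \<times> real) set) \<in> sets lebesgue"
    by (intro sets_completionI_sets) (simp add: borel_closed closed_Times)
  then show ?thesis
    by (simp add: AE_restrict_space_iff AE_completion_iff)
qed

lemma sets_unit_leb_iff: "A \<in> sets unit_leb \<longleftrightarrow> A \<in> sets lebesgue \<and> A \<subseteq> {0..1}"
  by (subst sets_restrict_space_iff) auto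

lemma emeasure_unit_leb: "A \<subseteq> {0..1} \<Longrightarrow> emeasure unit_leb A = emeasure lebesgue A"
  by (rule emeasure_restrict_space) auto

text \<open>The sides are only Lebesgue measurable, so Fubini is applied to Borel sets: to
  \<open>main_part\<close>, a Borel subset of equal measure, in one direction, and to a Borel null
  set containing the null side in the other. This links relations valid almost everywhere on the
  square with measures of sets on the line.\<close>

lemma null_rectangle_iff:
  assumes X: "X \<in> sets unit_leb" and Y: "Y \<in> sets unit_leb"
  shows "(AE (x, y) in square_leb. \<not> (x \<in> X \<and> y \<in> Y)) \<longleftrightarrow> measure unit_leb X = 0 \<or> measure unit_leb Y = 0"
proof -
  interpret prob_space unit_leb by (rule prob_space_unit_leb)
  have Xl: "X \<in> sets lebesgue" "X \<subseteq> {0..1}" and Yl: "Y \<in> sets lebesgue" "Y \<subseteq> {0..1}"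
    using X Y by (auto simp: sets_unit_leb_iff)
  have m0: "measure unit_leb A = 0 \<longleftrightarrow> emeasure lebesgue A = 0" if "A \<subseteq> {0..1}" for A
    using that by (simp add: measure_eq_emeasure_eq_ennreal emeasure_eq_measure flip: emeasure_unit_leb)
  let ?X = "main_part lborel X" and ?Y = "main_part lborel Y"
  have XX: "X = ?X \<union> null_part lborel X" "Y = ?Y \<union> null_part lborel Y"
    using Xl(1) Yl(1) main_part_null_part_Un by auto
  have main: "?X \<in> sets lborel" "?Y \<in> sets lborel"
    "emeasure lborel ?X = emeasure lebesgue X" "emeasure lborel ?Y = emeasure lebesgue Y"
    "?X \<subseteq> X" "?Y \<subseteq> Y"
    using Xl(1) Yl(1) main_part_sets[of X lborel] main_part_sets[of Y lborel]
    by (simp_all, use XX in blast, use XX in blast)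
  show ?thesis
  proof
    assume "AE (x, y) in square_leb. \<not> (x \<in> X \<and> y \<in> Y)"
    then have "AE p in lborel. p \<notin> ?X \<times> ?Y"
      unfolding AE_square_leb_iff by eventually_elim (use main Xl Yl in auto)
    moreover have "?X \<times> ?Y \<in> sets (lborel :: (real \<times> real) measure)"
      using main unfolding lborel_prod[symmetric] by auto
    ultimately have "emeasure (lborel :: (real \<times> real) measure) (?X \<times> ?Y) = 0"
      using AE_iff_null_sets null_setsD1 by blast
    then have "emeasure lborel ?X * emeasure lborel ?Y = 0"
      unfolding lborel_prod[symmetric] by (subst (asm) lborel.emeasure_pair_measure_Times) (use main in auto)
    then have "emeasure lebesgue X = 0 \<or> emeasure lebesgue Y = 0"
      unfolding main(3,4) by (simp only: mult_eq_0_iff)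
    then show "measure unit_leb X = 0 \<or> measure unit_leb Y = 0"
      by (simp only: m0[OF Xl(2)] m0[OF Yl(2)])
  next
    assume "measure unit_leb X = 0 \<or> measure unit_leb Y = 0"
    then have "X \<in> null_sets lebesgue \<or> Y \<in> null_sets lebesgue"
      unfolding m0[OF Xl(2)] m0[OF Yl(2)] by (metis null_setsI Xl(1) Yl(1))
    then obtain N where N: "N \<in> null_sets lborel" and "X \<subseteq> N \<or> Y \<subseteq> N"
      by (auto simp: null_sets_completion_iff2)
    then have sub: "X \<times> Y \<subseteq> N \<times> UNIV \<union> UNIV \<times> N" by auto
    have "N \<times> UNIV \<in> null_sets (lborel \<Otimes>\<^sub>M lborel)" "UNIV \<times> N \<in> null_sets (lborel \<Otimes>\<^sub>M lborel)"
      using N by (auto simp: null_sets_def lborel.emeasure_pair_measure_Times)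
    then have "AE p in lborel. p \<notin> N \<times> UNIV" "AE p in lborel. p \<notin> UNIV \<times> N"
      unfolding lborel_prod by (auto intro: AE_not_in)
    then show "AE (x, y) in square_leb. \<not> (x \<in> X \<and> y \<in> Y)"
      unfolding AE_square_leb_iff by eventually_elim (use sub in auto)
  qed
qed

lemma borel_measurable_label_pair:
  assumes "i \<in> I" "j \<in> I"
  shows "(\<lambda>x. (x i, x j)) \<in> (\<Pi>\<^sub>M i\<in>I. unit_leb) \<rightarrow>\<^sub>M lborel"
proof -
  have id: "(\<lambda>x. x) \<in> borel_measurable unit_leb"
    by (intro measurable_restrict_space1 measurable_completion) simp
  have "(\<lambda>x. x k) \<in> borel_measurable (\<Pi>\<^sub>M i\<in>I. unit_leb)" if "k \<in> I" for k
    using measurable_comp[OF measurable_component_singleton[OF that] id] by (simp add: comp_def)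
  then show ?thesis
    using assms by (simp add: borel_prod[symmetric])
qed

lemma emeasure_PiM_unit_leb_pair:
  assumes I: "finite I" "i \<in> I" "j \<in> I" "i \<noteq> j"
    and A: "A \<in> sets unit_leb" "B \<in> sets unit_leb"
  shows "emeasure (\<Pi>\<^sub>M i\<in>I. unit_leb) {x \<in> space (\<Pi>\<^sub>M i\<in>I. unit_leb). x i \<in> A \<and> x j \<in> B} =
         emeasure unit_leb A * emeasure unit_leb B"
proof -
  interpret U: prob_space unit_leb by (rule prob_space_unit_leb)
  interpret product_sigma_finite "\<lambda>_::'a. unit_leb" ..
  let ?E = "(\<lambda>_. {0..1})(i := A, j := B) :: 'a \<Rightarrow> real set"
  have AB: "A \<subseteq> {0..1}" "B \<subseteq> {0..1}"
    using A by (auto simp: sets_unit_leb_iff)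
  have "x \<in> space (\<Pi>\<^sub>M i\<in>I. unit_leb) \<and> x i \<in> A \<and> x j \<in> B \<longleftrightarrow> x \<in> Pi\<^sub>E I ?E" for x
    unfolding space_PiM PiE_iff using I AB by (auto 0 4 simp: subset_eq)
  then have "{x \<in> space (\<Pi>\<^sub>M i\<in>I. unit_leb). x i \<in> A \<and> x j \<in> B} = Pi\<^sub>E I ?E"
    by blast
  also have "emeasure (\<Pi>\<^sub>M i\<in>I. unit_leb) \<dots> = (\<Prod>k\<in>I. emeasure unit_leb (?E k))"
    using A I(1) by (subst emeasure_PiM) (auto simp: sets_unit_leb_iff)
  also have "\<dots> = (\<Prod>k\<in>{i, j}. emeasure unit_leb (?E k))"
    using I by (intro prod.mono_neutral_right) (auto simp: U.emeasure_space_1[simplified])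
  finally show ?thesis using I(4) by simp
qed

text \<open>Both measures equal the product of two uniform laws, because they give the same mass to
  every measurable rectangle.\<close>

lemma distr_label_pair:
  fixes I :: "'a set"
  assumes I: "finite I" "i \<in> I" "j \<in> I" "i \<noteq> j"
  shows "distr (\<Pi>\<^sub>M i\<in>I. unit_leb) lborel (\<lambda>x. (x i, x j)) = density lborel (indicator ({0..1} \<times> {0..1}))"
proof -
  interpret prob_space unit_leb by (rule prob_space_unit_leb)
  let ?U = "density lborel (indicator {0..1::real})" and ?PM = "\<Pi>\<^sub>M i\<in>I. unit_leb"
  note T = borel_measurable_label_pair[OF I(2,3)]
  have U: "emeasure ?U A = emeasure lborel (A \<inter> {0..1})" if "A \<in> sets borel" for A
    using that by (simp add: emeasure_density indicator_inter_arith[symmetric] Int_commute)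
  have "finite_measure ?U"
    by (intro finite_measureI) (use U[of UNIV] in simp)
  then interpret U: finite_measure ?U .
  have sf: "sigma_finite_measure ?U" ..
  have sq: "({0..1} \<times> {0..1} :: (real \<times> real) set) \<in> sets borel"
    by (simp add: borel_closed closed_Times)
  have "?U \<Otimes>\<^sub>M ?U = distr ?PM lborel (\<lambda>x. (x i, x j))"
  proof (rule pair_measure_eqI[OF sf sf])
    show "sets (?U \<Otimes>\<^sub>M ?U) = sets (distr ?PM lborel (\<lambda>x. (x i, x j)))"
      by (simp add: borel_prod[symmetric] cong: sets_pair_measure_cong)
  next
    fix A B assume "A \<in> sets ?U" "B \<in> sets ?U"
    then have A: "A \<in> sets borel" and B: "B \<in> sets borel" by auto
    have s: "A \<inter> {0..1} \<in> sets unit_leb" "B \<inter> {0..1} \<in> sets unit_leb"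
      using A B by (auto simp: sets_unit_leb_iff)
    have "emeasure (distr ?PM lborel (\<lambda>x. (x i, x j))) (A \<times> B)
        = emeasure ?PM {x \<in> space ?PM. x i \<in> A \<inter> {0..1} \<and> x j \<in> B \<inter> {0..1}}"
    proof (subst emeasure_distr[OF T])
      show "A \<times> B \<in> sets lborel"
        using A B by (simp add: borel_prod[symmetric])
      show "emeasure ?PM ((\<lambda>x. (x i, x j)) -` (A \<times> B) \<inter> space ?PM)
          = emeasure ?PM {x \<in> space ?PM. x i \<in> A \<inter> {0..1} \<and> x j \<in> B \<inter> {0..1}}"
        using I by (intro arg_cong[where f="emeasure ?PM"]) (auto simp: space_PiM)
    qed
    also have "\<dots> = emeasure unit_leb (A \<inter> {0..1}) * emeasure unit_leb (B \<inter> {0..1})"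
      by (rule emeasure_PiM_unit_leb_pair[OF I s])
    also have "\<dots> = emeasure ?U A * emeasure ?U B"
      using A B by (simp add: U emeasure_unit_leb)
    finally show "emeasure ?U A * emeasure ?U B = emeasure (distr ?PM lborel (\<lambda>x. (x i, x j))) (A \<times> B)" ..
  qed
  moreover have "?U \<Otimes>\<^sub>M ?U = density lborel (indicator ({0..1} \<times> {0..1}))"
  proof (rule pair_measure_eqI[OF sf sf])
    show "sets (?U \<Otimes>\<^sub>M ?U) = sets (density lborel (indicator ({0..1} \<times> {0..1})))"
      by (simp add: borel_prod[symmetric] cong: sets_pair_measure_cong)
  next
    fix A B assume "A \<in> sets ?U" "B \<in> sets ?U"
    then have A: "A \<in> sets borel" and B: "B \<in> sets borel" by auto
    have AB: "A \<times> B \<in> sets (lborel :: (real \<times> real) measure)"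
      using A B by (simp add: borel_prod[symmetric])
    have "emeasure (density lborel (indicator ({0..1} \<times> {0..1}))) (A \<times> B)
       = emeasure (lborel :: (real \<times> real) measure) ({0..1} \<times> {0..1} \<inter> A \<times> B)"
      using AB sq by (simp add: emeasure_density indicator_inter_arith[symmetric])
    also have "\<dots> = emeasure (lborel \<Otimes>\<^sub>M lborel) ((A \<inter> {0..1}) \<times> (B \<inter> {0..1}))"
      unfolding lborel_prod by (intro arg_cong[where f="emeasure lborel"]) auto
    also have "\<dots> = emeasure lborel (A \<inter> {0..1}) * emeasure lborel (B \<inter> {0..1})"
      using A B by (intro lborel.emeasure_pair_measure_Times) auto
    finally show "emeasure ?U A * emeasure ?U B = emeasure (density lborel (indicator ({0..1} \<times> {0..1}))) (A \<times> B)"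
      using A B by (simp add: U)
  qed
  ultimately show ?thesis by simp
qed

text \<open>A Borel map stays measurable into the completion once preimages of null sets are null.
  The joint density provides this for \<open>i \<noteq> j\<close>; a repeated label would be
  concentrated on the null diagonal.\<close>

lemma measurable_label_pair:
  assumes I: "finite I" "i \<in> I" "j \<in> I" "i \<noteq> j"
  shows "(\<lambda>x. (x i, x j)) \<in> completion (\<Pi>\<^sub>M i\<in>I. unit_leb) \<rightarrow>\<^sub>M square_leb"
proof (rule measurable_restrict_space2)
  let ?PM = "\<Pi>\<^sub>M i\<in>I. unit_leb"
  show "(\<lambda>x. (x i, x j)) \<in> space (completion ?PM) \<rightarrow> {0..1} \<times> {0..1}"
    using I by (auto simp: space_PiM)
  note T = borel_measurable_label_pair[OF I(2,3)]
  show "(\<lambda>x. (x i, x j)) \<in> completion ?PM \<rightarrow>\<^sub>M lebesgue"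
  proof (rule completion.measurable_completion2)
    show "(\<lambda>x. (x i, x j)) \<in> completion ?PM \<rightarrow>\<^sub>M lborel"
      by (rule measurable_completion[OF T])
    have sq: "(indicator ({0..1} \<times> {0..1}) :: real \<times> real \<Rightarrow> ennreal) \<in> borel_measurable lborel"
      by (intro borel_measurable_indicator) (simp add: borel_closed closed_Times)
    show "null_sets lborel \<subseteq> null_sets (distr (completion ?PM) lborel (\<lambda>x. (x i, x j)))"
      unfolding distr_completion[OF T] distr_label_pair[OF I]
    proof
      fix N :: "(real \<times> real) set" assume N: "N \<in> null_sets lborel"
      then show "N \<in> null_sets (density lborel (indicator ({0..1} \<times> {0..1})))"
        unfolding null_sets_density_iff[OF sq]
        using AE_not_in[OF N] by (auto intro: null_setsD2 elim: eventually_mono)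
    qed
  qed
qed

text \<open>A law with a density does not charge null sets. What is known almost everywhere about a
  mergeon reaches the sample through this lemma.\<close>

lemma AE_label_pair:
  assumes I: "finite I" "i \<in> I" "j \<in> I" "i \<noteq> j" and P: "AE (y, z) in square_leb. P y z"
  shows "AE x in completion (\<Pi>\<^sub>M i\<in>I. unit_leb). P (x i) (x j)"
proof -
  let ?PM = "\<Pi>\<^sub>M i\<in>I. unit_leb"
  note T = borel_measurable_label_pair[OF I(2,3)]
  have sq: "(indicator ({0..1} \<times> {0..1}) :: real \<times> real \<Rightarrow> ennreal) \<in> borel_measurable lborel"
    by (intro borel_measurable_indicator) (simp add: borel_closed closed_Times)
  have "AE p in density lborel (indicator ({0..1} \<times> {0..1})). case p of (y, z) \<Rightarrow> P y z"
    using P unfolding AE_square_leb_iff AE_density[OF sq]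
    by eventually_elim (auto split: split_indicator_asm)
  then have "AE x in ?PM. (case (x i, x j) of (y, z) \<Rightarrow> P y z)"
    unfolding distr_label_pair[OF I, symmetric] by (rule AE_distrD[OF T])
  then show ?thesis by (simp add: AE_completion_iff)
qed

lemma AE_label_component:
  assumes "i \<in> I" "AE y in unit_leb. P y"
  shows "AE x in completion (\<Pi>\<^sub>M i\<in>I. unit_leb). P (x i)"
  unfolding AE_completion_iff
  by (rule AE_PiM_component) (use assms prob_space_unit_leb in auto)

text \<open>The diagonal is null because its sections are points. Injectivity makes relabelling
  faithful: clusters of nodes and clusters of labels then correspond.\<close>

lemma AE_labels_inj:
  assumes "finite I"
  shows "AE x in completion (\<Pi>\<^sub>M i\<in>I. unit_leb). inj_on x I"
proof -
  have "AE x in completion (\<Pi>\<^sub>M i\<in>I. unit_leb). x i \<noteq> x j" if "i \<in> I" "j \<in> I" "i \<noteq> j" for i j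
  proof (rule AE_label_pair[OF assms that])
    have d: "{p. fst p = snd p} \<in> sets (lborel \<Otimes>\<^sub>M lborel :: (real \<times> real) measure)"
      unfolding lborel_prod by (simp add: borel_closed closed_Collect_eq continuous_on_fst continuous_on_snd continuous_on_id)
    have "emeasure (lborel \<Otimes>\<^sub>M lborel) {p. fst p = (snd p :: real)} = (\<integral>\<^sup>+x. emeasure lborel {x :: real} \<partial>lborel)"
      by (subst lborel.emeasure_pair_measure_alt[OF d]) (auto intro!: nn_integral_cong arg_cong[where f="emeasure lborel"])
    then have "{p. fst p = snd p} \<in> null_sets (lborel :: (real \<times> real) measure)"
      using d unfolding lborel_prod by (auto intro: null_setsI)
    then have "AE p in lborel. fst p \<noteq> (snd p :: real)"
      by (auto dest: AE_not_in)
    then show "AE (y, z) in square_leb. y \<noteq> z"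
      unfolding AE_square_leb_iff by eventually_elim auto
  qed
  then have "AE x in completion (\<Pi>\<^sub>M i\<in>I. unit_leb). \<forall>i\<in>I. \<forall>j\<in>I. i \<noteq> j \<longrightarrow> x i \<noteq> x j"
    using assms by (simp add: eventually_ball_finite_distrib)
  then show ?thesis
    by eventually_elim (auto simp: inj_on_def)
qed

section \<open>The label marginal of the random graph model\<close>

section \<open>The label measure\<close>

definition labels :: "nat \<Rightarrow> (nat \<Rightarrow> real) measure" where
  "labels n = completion (\<Pi>\<^sub>M i\<in>{1..n}. unit_leb)"

lemma space_labels: "space (labels n) = {1..n} \<rightarrow>\<^sub>E {0..1}"
  by (simp add: labels_def space_PiM)

lemma label_in_unit: "x \<in> space (labels n) \<Longrightarrow> i \<in> {1..n} \<Longrightarrow> x i \<in> {0..1}"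
  unfolding space_labels by (rule PiE_mem)

lemma prob_space_labels_n: "prob_space (labels n)"
  unfolding labels_def by (rule prob_space_labels)

lemma label_measure_eq_density_labels:
  "label_measure W n = density (count_space (graphs n) \<Otimes>\<^sub>M labels n) (\<lambda>(G, x). ennreal (graph_likelihood W n G x))"
  unfolding label_measure_def labels_def ..

lemma borel_measurable_label_pair_graphon:
  assumes "graphon W" "i \<in> {1..n}" "j \<in> {1..n}" "i \<noteq> j"
  shows "(\<lambda>x. W (x i) (x j)) \<in> borel_measurable (labels n)"
proof -
  have "(\<lambda>(x, y). W x y) \<in> borel_measurable square_leb"
    using assms by (simp add: graphon_def)
  from measurable_compose[OF measurable_label_pair[OF _ assms(2-4)] this] show ?thesis
    by (simp add: labels_def)
qed

text \<open>Expand \<open>\<Prod>p\<in>A. q p + (1 - q p)\<close> over the subsets of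
  \<open>A\<close>. With \<open>e\<close> encoding pairs of nodes as edges, these subsets are the
  graphs.\<close>

lemma sum_prod_Bernoulli:
  fixes q :: "'a \<Rightarrow> real"
  assumes A: "finite A" and e: "inj_on e A"
  shows "(\<Sum>G\<in>Pow (e ` A). \<Prod>p\<in>A. if e p \<in> G then q p else 1 - q p) = 1"
proof -
  have "(\<Sum>G\<in>Pow (e ` A). \<Prod>p\<in>A. if e p \<in> G then q p else 1 - q p)
      = (\<Sum>X\<in>Pow A. \<Prod>p\<in>A. if e p \<in> e ` X then q p else 1 - q p)"
    unfolding image_Pow_surj[OF refl, symmetric]
    by (subst sum.reindex) (auto intro: inj_on_image_Pow e)
  also have "\<dots> = (\<Sum>X\<in>Pow A. (\<Prod>p\<in>X. q p) * (\<Prod>p\<in>A - X. 1 - q p))"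
  proof (rule sum.cong[OF refl])
    fix X assume X: "X \<in> Pow A"
    then have "e p \<in> e ` X \<longleftrightarrow> p \<in> X" if "p \<in> A" for p
      using e that by (auto simp: inj_on_def)
    then have "(\<Prod>p\<in>A. if e p \<in> e ` X then q p else 1 - q p) = (\<Prod>p\<in>A. if p \<in> X then q p else 1 - q p)"
      by (intro prod.cong) auto
    also have "\<dots> = (\<Prod>p\<in>X. q p) * (\<Prod>p\<in>A - X. 1 - q p)"
      using X A by (subst prod.If_cases) (auto simp: Int_absorb1 Diff_eq)
    finally show "(\<Prod>p\<in>A. if e p \<in> e ` X then q p else 1 - q p) = (\<Prod>p\<in>X. q p) * (\<Prod>p\<in>A - X. 1 - q p)" .
  qed
  also have "\<dots> = (\<Prod>p\<in>A. q p + (1 - q p))"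
    by (rule prod_add[OF A, symmetric])
  finally show ?thesis by simp
qed

lemma graphs_eq_Pow_image:
  "graphs n = Pow ((\<lambda>(i, j). {i, j}) ` {(i, j). i \<in> {1..n} \<and> j \<in> {1..n} \<and> i < j})"
proof -
  have "{e. e \<subseteq> {1..n} \<and> card e = 2} = (\<lambda>(i, j). {i, j}) ` {(i, j). i \<in> {1..n} \<and> j \<in> {1..n} \<and> i < j}"
    (is "?L = ?R")
  proof
    show "?R \<subseteq> ?L" by (auto simp: card_insert_if)
    show "?L \<subseteq> ?R"
    proof
      fix e assume e: "e \<in> ?L"
      then obtain a b where "e = {a, b}" "a \<noteq> b" by (auto simp: card_2_iff)
      with e have "e = {min a b, max a b}" "min a b < max a b" "min a b \<in> {1..n}" "max a b \<in> {1..n}"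
        by (auto simp: min_def max_def)
      then show "e \<in> ?R" by (intro image_eqI[where x="(min a b, max a b)"]) auto
    qed
  qed
  then show ?thesis by (simp add: graphs_def)
qed

lemma finite_graphs: "finite (graphs n)"
  by (auto simp: graphs_def intro: finite_subset[OF _ finite_Pow_iff[THEN iffD2, of "{1..n}"]])

lemma sum_graph_likelihood: "(\<Sum>G\<in>graphs n. graph_likelihood W n G x) = 1"
proof -
  let ?A = "{(i, j). i \<in> {1..n} \<and> j \<in> {1..n} \<and> i < j}"
  have "finite ?A"
    by (rule finite_subset[of _ "{1..n} \<times> {1..n}"]) auto
  moreover have "inj_on (\<lambda>(i, j). {i, j}) ?A"
    by (auto simp: inj_on_def doubleton_eq_iff)
  ultimately show ?thesis
    using sum_prod_Bernoulli[of ?A "\<lambda>(i, j). {i, j}" "\<lambda>p. W (x (fst p)) (x (snd p))"]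
    unfolding graphs_eq_Pow_image graph_likelihood_def case_prod_unfold by simp
qed

lemma graph_likelihood_nonneg:
  assumes "graphon W" "x \<in> space (labels n)"
  shows "0 \<le> graph_likelihood W n G x"
  unfolding graph_likelihood_def
proof (rule prod_nonneg, clarify)
  fix i j assume "i \<in> {1..n}" "j \<in> {1..n}"
  then have "W (x i) (x j) \<in> {0..1}"
    using assms(1) label_in_unit[OF assms(2)] by (simp add: graphon_def)
  then show "0 \<le> (if {i, j} \<in> G then W (x i) (x j) else 1 - W (x i) (x j))"
    by simp
qed

lemma borel_measurable_graph_likelihood:
  assumes "graphon W"
  shows "graph_likelihood W n G \<in> borel_measurable (labels n)"
proof -
  have "(\<lambda>x. if {i, j} \<in> G then W (x i) (x j) else 1 - W (x i) (x j)) \<in> borel_measurable (labels n)"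
    if "i \<in> {1..n}" "j \<in> {1..n}" "i < j" for i j
    using borel_measurable_label_pair_graphon[OF assms that(1,2)] that by simp
  then show ?thesis
    unfolding graph_likelihood_def by (intro borel_measurable_prod) auto
qed

lemma space_label_measure: "space (label_measure W n) = graphs n \<times> space (labels n)"
  by (simp add: label_measure_eq_density_labels space_pair_measure)

text \<open>With finitely many graphs, the slices at fixed graphs decide measurability. Each slice
  lies in a complete space, so it only has to be known up to a null set.\<close>

lemma sets_label_measureI:
  assumes "E \<subseteq> graphs n \<times> space (labels n)"
    and "\<And>G. G \<in> graphs n \<Longrightarrow> {x \<in> space (labels n). (G, x) \<in> E} \<in> sets (labels n)"
  shows "E \<in> sets (label_measure W n)"
proof -
  have "(\<lambda>p. p \<in> E) \<in> count_space (graphs n) \<Otimes>\<^sub>M labels n \<rightarrow>\<^sub>M count_space UNIV"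
    using assms(2) by (intro measurable_pair_measure_countable1 countable_finite finite_graphs)
      (simp add: pred_def)
  then have "{p \<in> space (count_space (graphs n) \<Otimes>\<^sub>M labels n). p \<in> E} \<in> sets (count_space (graphs n) \<Otimes>\<^sub>M labels n)"
    by (simp add: pred_def)
  moreover have "{p \<in> space (count_space (graphs n) \<Otimes>\<^sub>M labels n). p \<in> E} = E"
    using assms(1) by (auto simp: space_pair_measure)
  ultimately show ?thesis
    by (simp add: label_measure_eq_density_labels)
qed

text \<open>Given the labels, the likelihoods of all graphs sum to 1, so integrating out the graph
  leaves independent uniform labels. Total mass 1 and almost sure statements about labels carry over
  through this identity.\<close>

lemma emeasure_label_measure_Times:
  assumes W: "graphon W" and A: "A \<in> sets (labels n)"
  shows "emeasure (label_measure W n) (graphs n \<times> A) = emeasure (labels n) A"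
proof -
  interpret prob_space "labels n" by (rule prob_space_labels_n)
  let ?C = "count_space (graphs n)"
  let ?L = "\<lambda>G x. ennreal (graph_likelihood W n G x)"
  have L: "?L G \<in> borel_measurable (labels n)" for G
    using borel_measurable_graph_likelihood[OF W] by simp
  have m: "(\<lambda>(G, x). ?L G x) \<in> borel_measurable (?C \<Otimes>\<^sub>M labels n)"
    using L by (intro measurable_pair_measure_countable1 countable_finite finite_graphs) simp
  have GA: "graphs n \<times> A \<in> sets (?C \<Otimes>\<^sub>M labels n)"
    using A by auto
  have "emeasure (label_measure W n) (graphs n \<times> A)
      = (\<integral>\<^sup>+ p. (case p of (G, x) \<Rightarrow> ?L G x) * indicator (graphs n \<times> A) p \<partial>(?C \<Otimes>\<^sub>M labels n))"
    unfolding label_measure_eq_density_labels by (rule emeasure_density[OF m GA])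
  also have "\<dots> = (\<integral>\<^sup>+ G. \<integral>\<^sup>+ x. ?L G x * indicator (graphs n \<times> A) (G, x) \<partial>labels n \<partial>?C)"
    using m GA by (subst nn_integral_fst[symmetric]) (auto intro!: borel_measurable_times_ennreal)
  also have "\<dots> = (\<integral>\<^sup>+ G. \<integral>\<^sup>+ x. ?L G x * indicator A x \<partial>labels n \<partial>?C)"
    by (auto intro!: nn_integral_cong simp: indicator_def)
  also have "\<dots> = (\<Sum>G\<in>graphs n. \<integral>\<^sup>+ x. ?L G x * indicator A x \<partial>labels n)"
    using finite_graphs by (rule nn_integral_count_space_finite)
  also have "\<dots> = (\<integral>\<^sup>+ x. (\<Sum>G\<in>graphs n. ?L G x * indicator A x) \<partial>labels n)"
    using L A by (intro nn_integral_sum[symmetric]) auto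
  also have "\<dots> = (\<integral>\<^sup>+ x. indicator A x \<partial>labels n)"
  proof (rule nn_integral_cong)
    fix x assume "x \<in> space (labels n)"
    then have "(\<Sum>G\<in>graphs n. ?L G x) = 1"
      using graph_likelihood_nonneg[OF W] by (simp add: sum_ennreal sum_graph_likelihood)
    then show "(\<Sum>G\<in>graphs n. ?L G x * indicator A x) = indicator A x"
      by (simp flip: sum_distrib_right)
  qed
  finally show ?thesis using A by simp
qed

lemma prob_space_label_measure:
  assumes "graphon W"
  shows "prob_space (label_measure W n)"
proof
  interpret prob_space "labels n" by (rule prob_space_labels_n)
  show "emeasure (label_measure W n) (space (label_measure W n)) = 1"
    unfolding space_label_measure emeasure_label_measure_Times[OF assms sets.top]
    by (rule emeasure_space_1)
qed

lemma AE_label_measure: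
  assumes W: "graphon W" and P: "AE x in labels n. P x"
  shows "AE (G, x) in label_measure W n. P x"
proof -
  from P obtain N where N: "N \<in> null_sets (labels n)" "{x \<in> space (labels n). \<not> P x} \<subseteq> N"
    by (auto simp: eventually_ae_filter)
  have "graphs n \<times> N \<in> null_sets (label_measure W n)"
  proof (rule null_setsI)
    show "emeasure (label_measure W n) (graphs n \<times> N) = 0"
      using N(1) by (simp only: emeasure_label_measure_Times[OF W null_setsD2[OF N(1)]] null_setsD1)
    show "graphs n \<times> N \<in> sets (label_measure W n)"
      using null_setsD2[OF N(1)] unfolding label_measure_eq_density_labels by auto
  qed
  then show ?thesis
    using N(2) by (auto simp: eventually_ae_filter space_label_measure intro!: bexI[of _ "graphs n \<times> N"])
qed

text \<open>The event depends on the labels alone and is a box with equal sides, so the factors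
  multiply. For \<open>Q\<close> of positive measure the probability decays geometrically in
  \<open>n\<close>.\<close>

lemma measure_no_label_in:
  fixes n :: nat
  assumes W: "graphon W" and Q: "Q \<in> sets unit_leb"
  defines "E \<equiv> {(G, x) \<in> space (label_measure W n). \<forall>i\<in>{1..n}. x i \<notin> Q}"
  shows "E \<in> sets (label_measure W n)"
    and "measure (label_measure W n) E = (1 - measure unit_leb Q) ^ n"
proof -
  interpret U: prob_space unit_leb by (rule prob_space_unit_leb)
  interpret finite_product_prob_space "\<lambda>_::nat. unit_leb" "{1..n}" by standard simp
  let ?A = "{1..n} \<rightarrow>\<^sub>E ({0..1} - Q)"
  have E: "E = graphs n \<times> ?A"
    unfolding E_def space_label_measure space_labels by auto
  have c: "{0..1} - Q \<in> sets unit_leb"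
    using Q sets.compl_sets[OF Q] by simp
  have A: "?A \<in> sets (\<Pi>\<^sub>M i\<in>{1..n}. unit_leb)"
    by (rule sets_PiM_I_finite) (use c in auto)
  have A': "?A \<in> sets (labels n)"
    using A unfolding labels_def by (rule sets_completionI_sets)
  show "E \<in> sets (label_measure W n)"
    unfolding E label_measure_eq_density_labels using A' by auto
  have "measure (label_measure W n) E = measure (labels n) ?A"
    unfolding E measure_def emeasure_label_measure_Times[OF W A'] ..
  also have "\<dots> = (\<Prod>i\<in>{1..n}. measure unit_leb ({0..1} - Q))"
    unfolding labels_def measure_completion[OF A] by (rule prob_times) (rule c)
  also have "\<dots> = (1 - measure unit_leb Q) ^ n"
    using U.prob_compl[OF Q] by simp
  finally show "measure (label_measure W n) E = (1 - measure unit_leb Q) ^ n" .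
qed

section \<open>Unions of connected sets and countability of the clusters\<close>

section \<open>Clusters\<close>

lemma AE_square_leb_snd:
  assumes "Y \<in> sets unit_leb" "measure unit_leb Y = 0"
  shows "AE (x, y) in square_leb. y \<notin> Y"
proof -
  have 1: "AE (x, y) in square_leb. \<not> (x \<in> {0..1} \<and> y \<in> Y)"
    by (subst null_rectangle_iff) (use assms in \<open>auto simp: sets_unit_leb_iff\<close>)
  have 2: "AE p in square_leb. p \<in> {0..1} \<times> {0..1}"
    unfolding AE_square_leb_iff by simp
  show ?thesis
    using 1 2 by eventually_elim auto
qed

lemma AE_square_leb_unit: "AE (x, y) in square_leb. x \<in> {0..1} \<and> y \<in> {0..1}"
  unfolding AE_square_leb_iff by auto

lemma null_of_AE_less:
  fixes W :: "real \<Rightarrow> real \<Rightarrow> real"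
  assumes "AE (x, y) in square_leb. x \<in> S \<and> y \<in> T \<longrightarrow> W x y < l"
    and "X \<in> sets unit_leb" "Y \<in> sets unit_leb" "X \<subseteq> S" "Y \<subseteq> T"
    and "\<And>x y. x \<in> X \<Longrightarrow> y \<in> Y \<Longrightarrow> l \<le> W x y"
  shows "measure unit_leb X = 0 \<or> measure unit_leb Y = 0"
proof -
  have "AE (x, y) in square_leb. \<not> (x \<in> X \<and> y \<in> Y)"
    using assms(1)
  proof eventually_elim
    case (elim p)
    obtain x y where p: "p = (x, y)" by (cases p)
    have "\<not> (x \<in> X \<and> y \<in> Y)"
    proof
      assume "x \<in> X \<and> y \<in> Y"
      then have "x \<in> S" "y \<in> T" "l \<le> W x y"
        using assms(4,5) assms(6) by auto
      then show False using elim unfolding p by simp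
    qed
    then show ?case by (simp add: p)
  qed
  then show ?thesis
    unfolding null_rectangle_iff[OF assms(2,3)] .
qed

text \<open>A separating set \<open>S\<close> of the union cannot cut \<open>A1\<close> or
  \<open>A2\<close> properly, so up to null sets it contains or misses each. Containing both or
  missing both contradicts the bounds on \<open>prob S\<close>; containing just one makes the
  intersection null.\<close>

lemma connected_sets_Un:
  assumes A1: "A1 \<in> connected_sets W l" and A2: "A2 \<in> connected_sets W l"
    and pos: "measure unit_leb (A1 \<inter> A2) > 0"
  shows "A1 \<union> A2 \<in> connected_sets W l"
proof -
  interpret prob_space unit_leb by (rule prob_space_unit_leb)
  have m: "A1 \<in> events" "A2 \<in> events" "prob A1 > 0" "prob A2 > 0"
    using A1 A2 by (auto simp: connected_sets_def)
  have "\<not> disconnected_at W l' (A1 \<union> A2)" if l': "l' < l" for l'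
  proof
    assume "disconnected_at W l' (A1 \<union> A2)"
    then obtain S where S: "S \<in> events" "S \<subseteq> A1 \<union> A2" "0 < prob S" "prob S < prob (A1 \<union> A2)"
      and AE: "AE (x, y) in square_leb. x \<in> S \<and> y \<in> (A1 \<union> A2) - S \<longrightarrow> W x y < l'"
      unfolding disconnected_at_def by blast
    have *: "prob (S \<inter> B) = 0 \<or> prob (B - S) = 0" if B: "B \<in> connected_sets W l" "B \<subseteq> A1 \<union> A2" for B
    proof (rule ccontr)
      assume "\<not> ?thesis"
      then have n0: "prob (S \<inter> B) \<noteq> 0" "prob (B - S) \<noteq> 0"
        by auto
      have Be: "B \<in> events" using B by (auto simp: connected_sets_def)
      have "AE (x, y) in square_leb. x \<in> S \<inter> B \<and> y \<in> B - (S \<inter> B) \<longrightarrow> W x y < l'"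
        using AE by eventually_elim (use B in auto)
      moreover have "prob B = prob (S \<inter> B) + prob (B - S)"
        using finite_measure_Union'[of "B \<inter> S" "B - S"] finite_measure_Diff'[OF Be S(1)]
        by (simp add: Int_commute)
      then have "prob (S \<inter> B) < prob B" "0 < prob (S \<inter> B)"
        using n0 measure_nonneg[of unit_leb "B - S"] measure_nonneg[of unit_leb "S \<inter> B"] by linarith+
      ultimately have "disconnected_at W l' B"
        unfolding disconnected_at_def using S Be by (intro bexI[of _ "S \<inter> B"]) auto
      then show False
        using B l' by (auto simp: connected_sets_def)
    qed
    have z: "prob C = 0" if "C \<subseteq> D \<union> E" "prob D = 0" "prob E = 0" "D \<in> events" "E \<in> events" for C D E
    proof -
      have "prob C \<le> prob (D \<union> E)"
        using that by (intro finite_measure_mono) auto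
      also have "\<dots> \<le> 0"
        using measure_Un_le[of D unit_leb E] that by simp
      finally show ?thesis by (simp add: measure_le_0_iff)
    qed
    have "prob (S \<inter> A1) = 0 \<or> prob (A1 - S) = 0" "prob (S \<inter> A2) = 0 \<or> prob (A2 - S) = 0"
      using *[OF A1] *[OF A2] by auto
    then consider "prob (S \<inter> A1) = 0" "prob (S \<inter> A2) = 0" | "prob (A1 - S) = 0" "prob (A2 - S) = 0"
      | "prob (S \<inter> A1) = 0" "prob (A2 - S) = 0" | "prob (A1 - S) = 0" "prob (S \<inter> A2) = 0"
      by blast
    then show False
    proof cases
      case 1
      have "prob S = 0"
        by (rule z[of S "S \<inter> A1" "S \<inter> A2"]) (use S m 1 in auto)
      then show False using S by simp
    next
      case 2
      have "prob (A1 \<union> A2 - S) = 0"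
        by (rule z[of _ "A1 - S" "A2 - S"]) (use S(1) m 2 in blast)+
      moreover have "prob (A1 \<union> A2 - S) = prob (A1 \<union> A2) - prob S"
        using S m by (intro finite_measure_Diff) blast+
      ultimately show False using S by simp
    next
      case 3
      have "prob (A1 \<inter> A2) = 0"
        by (rule z[of _ "S \<inter> A1" "A2 - S"]) (use S(1) m 3 in blast)+
      then show False using pos by simp
    next
      case 4
      have "prob (A1 \<inter> A2) = 0"
        by (rule z[of _ "A1 - S" "S \<inter> A2"]) (use S(1) m 4 in blast)+
      then show False using pos by simp
    qed
  qed
  moreover have "prob (A1 \<union> A2) > 0"
    using m finite_measure_mono[of A1 "A1 \<union> A2"] by auto
  ultimately show ?thesis
    using m by (auto simp: connected_sets_def)
qed

lemma connected_sets_Un_mono: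
  assumes "A1 \<in> connected_sets W l" "A2 \<in> connected_sets W l" "B \<in> connected_sets W l" "B \<subseteq> A1 \<inter> A2"
  shows "A1 \<union> A2 \<in> connected_sets W l"
proof (rule connected_sets_Un[OF assms(1,2)])
  interpret prob_space unit_leb by (rule prob_space_unit_leb)
  have "prob B \<le> prob (A1 \<inter> A2)"
    using assms by (intro finite_measure_mono) (auto simp: connected_sets_def)
  then show "prob (A1 \<inter> A2) > 0"
    using assms(3) by (simp add: connected_sets_def)
qed

text \<open>Only transitivity has content: the two witnesses share \<open>A2\<close>, a set of
  positive measure, so their union is again connected.\<close>

lemma equiv_cluster_rel: "equiv (connected_sets W l) (cluster_rel W l)"
proof (rule equivI)
  show "cluster_rel W l \<subseteq> connected_sets W l \<times> connected_sets W l"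
    by (auto simp: cluster_rel_def)
  show "refl_on (connected_sets W l) (cluster_rel W l)"
    by (auto simp: refl_on_def cluster_rel_def)
  show "sym (cluster_rel W l)"
    by (auto simp: sym_def cluster_rel_def)
  show "trans (cluster_rel W l)"
  proof (rule transI)
    fix A1 A2 A3 assume "(A1, A2) \<in> cluster_rel W l" "(A2, A3) \<in> cluster_rel W l"
    then obtain B B' where "B \<in> connected_sets W l" "A1 \<union> A2 \<subseteq> B" "B' \<in> connected_sets W l" "A2 \<union> A3 \<subseteq> B'"
      and A: "A1 \<in> connected_sets W l" "A2 \<in> connected_sets W l" "A3 \<in> connected_sets W l"
      unfolding cluster_rel_def by auto
    then have "B \<union> B' \<in> connected_sets W l" "A1 \<union> A3 \<subseteq> B \<union> B'"
      using connected_sets_Un_mono[of B W l B' A2] by auto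
    then show "(A1, A3) \<in> cluster_rel W l"
      using A unfolding cluster_rel_def by blast
  qed
qed

text \<open>An essential maximum is an element of its equivalence class, and any element determines
  the class. Hence one representative determines the whole cluster.\<close>

lemma mem_clusterD:
  assumes "C \<in> clusters W l" "A \<in> C"
  shows "A \<in> connected_sets W l" and "C = ess_max (cluster_rel W l `` {A})"
proof -
  obtain X where X: "X \<in> connected_sets W l // cluster_rel W l" "C = ess_max X"
    using assms(1) unfolding clusters_def by blast
  then have AX: "A \<in> X"
    using assms(2) by (simp add: ess_max_def)
  show A: "A \<in> connected_sets W l"
    using X(1) AX in_quotient_imp_subset[OF equiv_cluster_rel] by blast
  have "X = cluster_rel W l `` {A}"
    using X(1) AX by (metis quotientE equiv_class_eq_iff equiv_cluster_rel Image_singleton_iff)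
  then show "C = ess_max (cluster_rel W l `` {A})"
    using X(2) by simp
qed

text \<open>A positive overlap would make the union connected, so the two representatives would be
  equivalent and determine the same cluster.\<close>

lemma clusters_ae_disjoint:
  assumes "C \<in> clusters W l" "A \<in> C" "C' \<in> clusters W l" "A' \<in> C'" "C \<noteq> C'"
  shows "measure unit_leb (A \<inter> A') = 0"
proof (rule ccontr)
  assume "measure unit_leb (A \<inter> A') \<noteq> 0"
  then have "measure unit_leb (A \<inter> A') > 0"
    using measure_nonneg[of unit_leb "A \<inter> A'"] by linarith
  then have "A \<union> A' \<in> connected_sets W l"
    using mem_clusterD(1)[OF assms(1,2)] mem_clusterD(1)[OF assms(3,4)] connected_sets_Un by blast
  then have "(A, A') \<in> cluster_rel W l"
    using mem_clusterD(1)[OF assms(1,2)] mem_clusterD(1)[OF assms(3,4)] unfolding cluster_rel_def by blast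
  then have "cluster_rel W l `` {A} = cluster_rel W l `` {A'}"
    by (rule equiv_class_eq[OF equiv_cluster_rel])
  then show False
    using mem_clusterD(2)[OF assms(1,2)] mem_clusterD(2)[OF assms(3,4)] assms(5) by simp
qed

text \<open>Null overlaps preserve finite additivity, so the finite partial sums are bounded by the
  total mass; a summable family has only countably many nonzero terms.\<close>

lemma (in finite_measure) countable_ae_disjoint:
  assumes meas: "\<And>i. i \<in> I \<Longrightarrow> A i \<in> sets M" and pos: "\<And>i. i \<in> I \<Longrightarrow> measure M (A i) > 0"
    and disj: "\<And>i j. i \<in> I \<Longrightarrow> j \<in> I \<Longrightarrow> i \<noteq> j \<Longrightarrow> measure M (A i \<inter> A j) = 0"
  shows "countable I"
proof -
  have "(\<Sum>i\<in>J. measure M (A i)) \<le> measure M (space M)" if J: "finite J" "J \<subseteq> I" for J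
  proof -
    have "(\<Sum>i\<in>J. measure M (A i)) = measure M (\<Union>i\<in>J. A i)"
      using J
    proof (induction J)
      case (insert j J)
      have "measure M (A j \<inter> (\<Union>i\<in>J. A i)) \<le> (\<Sum>i\<in>J. measure M (A j \<inter> A i))"
        using insert meas finite_measure_subadditive_finite[of J "\<lambda>i. A j \<inter> A i"] by fastforce
      also have "\<dots> = 0"
        using insert disj by (intro sum.neutral) auto
      finally have "measure M (A j \<inter> (\<Union>i\<in>J. A i)) = 0"
        by (simp add: measure_le_0_iff)
      moreover have "(\<Union>i\<in>J. A i) \<in> sets M"
        using insert meas by (intro sets.finite_UN) auto
      ultimately have "measure M (A j \<union> (\<Union>i\<in>J. A i)) = measure M (A j) + measure M (\<Union>i\<in>J. A i)"
        using insert meas by (subst measure_Un3) (auto simp: fmeasurable_eq_sets)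
      then show ?case using insert by simp
    qed simp
    also have "\<dots> \<le> measure M (space M)"
      by (rule bounded_measure)
    finally show ?thesis .
  qed
  then have "(\<lambda>i. measure M (A i)) summable_on I"
    by (intro nonneg_bounded_partial_sums_imp_summable_on[where C="measure M (space M)"])
      (auto simp: eventually_finite_subsets_at_top intro!: exI[of _ "{}"])
  then have "countable {i \<in> I. measure M (A i) \<noteq> 0}"
    by (rule summable_countable_real)
  moreover have "{i \<in> I. measure M (A i) \<noteq> 0} = I"
    using pos by force
  ultimately show ?thesis by simp
qed

text \<open>Countability lets a statement valid almost everywhere for each cluster hold almost
  everywhere for all clusters at once. The choice \<open>r\<close> comes with a mergeon and carries
  the information that no cluster is empty.\<close>

lemma countable_clusters:
  assumes r: "\<forall>C\<in>clusters W l. r C \<in> C"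
  shows "countable (clusters W l)"
proof -
  interpret prob_space unit_leb by (rule prob_space_unit_leb)
  show ?thesis
  proof (rule countable_ae_disjoint[of _ r])
    fix C assume "C \<in> clusters W l"
    then have "r C \<in> connected_sets W l"
      using r mem_clusterD(1) by blast
    then show "r C \<in> events" "prob (r C) > 0"
      by (auto simp: connected_sets_def)
  next
    fix C D assume "C \<in> clusters W l" "D \<in> clusters W l" "C \<noteq> D"
    then show "prob (r C \<inter> r D) = 0"
      using r clusters_ae_disjoint by blast
  qed
qed

text \<open>Since \<open>r\<close> selects from every cluster, the class of \<open>A\<close> has an
  essential maximum, and this contains \<open>A\<close> up to a null set.\<close>

lemma connected_set_in_cluster:
  assumes r: "\<forall>C\<in>clusters W l. r C \<in> C" and A: "A \<in> connected_sets W l"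
  shows "\<exists>C\<in>clusters W l. measure unit_leb (A - r C) = 0"
proof -
  let ?X = "cluster_rel W l `` {A}"
  have "ess_max ?X \<in> clusters W l"
    unfolding clusters_def using A by (intro imageI quotientI)
  moreover have "A \<in> ?X"
    using A by (auto simp: cluster_rel_def)
  ultimately show ?thesis
    using r unfolding ess_max_def by (intro bexI[of _ "ess_max ?X"]) (auto simp: ess_max_def)
qed

section \<open>Grid refinement of the Lipschitz pieces\<close>

section \<open>Fine partitions\<close>

text \<open>Half-open cells are disjoint; the price is that the endpoint 1 falls in cell
  \<open>N\<close>, so indices run up to \<open>N\<close> inclusive.\<close>

definition grid_cell :: "nat \<Rightarrow> nat \<Rightarrow> real set" where
  "grid_cell N k = {real k / real N ..< (real k + 1) / real N}"

lemma grid_cell_cover: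
  assumes "N > 0" "x \<in> {0..1}"
  shows "\<exists>k\<le>N. x \<in> grid_cell N k"
proof (intro exI conjI)
  define k where "k = nat \<lfloor>real N * x\<rfloor>"
  have "0 \<le> real N * x" "real N * x \<le> real N"
    using assms by (auto simp: mult_left_le)
  then have k: "real k \<le> real N * x" "real N * x < real k + 1"
    unfolding k_def by linarith+
  then show "x \<in> grid_cell N k"
    using assms by (simp add: grid_cell_def field_simps)
  show "k \<le> N"
    using k \<open>real N * x \<le> real N\<close> by linarith
qed

lemma grid_cell_diff:
  assumes "N > 0" "x \<in> grid_cell N k" "y \<in> grid_cell N k"
  shows "\<bar>x - y\<bar> \<le> 1 / real N"
  using assms by (auto simp: grid_cell_def add_divide_distrib)

lemma grid_cell_disjoint:
  assumes "N > 0" "x \<in> grid_cell N j" "x \<in> grid_cell N k"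
  shows "j = k"
proof -
  have "real j < real k + 1" "real k < real j + 1"
    using assms by (auto simp: grid_cell_def field_simps)
  then show ?thesis by linarith
qed

lemma sets_Int_grid_cell: "B \<in> sets unit_leb \<Longrightarrow> B \<inter> grid_cell N k \<in> sets unit_leb"
  by (auto simp: sets_unit_leb_iff grid_cell_def)

lemma measure_Int_grid_cell_le:
  assumes "N > 0" "B \<in> sets unit_leb"
  shows "measure unit_leb (B \<inter> grid_cell N k) \<le> 1 / real N"
proof -
  have "measure unit_leb (B \<inter> grid_cell N k) = measure lebesgue (B \<inter> grid_cell N k)"
    using assms(2) by (intro measure_restrict_space) (auto simp: sets_unit_leb_iff)
  also have "\<dots> \<le> measure lebesgue (grid_cell N k)"
    using assms(2)
    by (intro measure_mono_fmeasurable bounded_set_imp_lmeasurable) (auto simp: sets_unit_leb_iff grid_cell_def)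
  also have "\<dots> = 1 / real N"
    using assms(1) by (simp add: grid_cell_def divide_right_mono add_divide_distrib)
  finally show ?thesis .
qed

text \<open>Atomlessness of Lebesgue measure: some cell of a fine grid carries mass of
  \<open>B\<close>, and every cell has length below \<open>m\<close>. The result supplies the small
  piece that can be split off from a part without neighbours.\<close>

lemma small_subset:
  assumes B: "B \<in> sets unit_leb" "measure unit_leb B > 0" and m: "m > 0"
  shows "\<exists>S\<in>sets unit_leb. S \<subseteq> B \<and> 0 < measure unit_leb S \<and> measure unit_leb S < m"
proof -
  interpret prob_space unit_leb by (rule prob_space_unit_leb)
  obtain N :: nat where N: "N > 0" "1 / real N < m"
    using m by (metis ex_inverse_of_nat_less inverse_eq_divide)
  have "\<exists>k\<le>N. prob (B \<inter> grid_cell N k) > 0"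
  proof (rule ccontr)
    assume "\<not> ?thesis"
    then have z: "prob (B \<inter> grid_cell N k) = 0" if "k \<le> N" for k
      using that by (meson measure_le_0_iff not_le)
    have "B = (\<Union>k\<le>N. B \<inter> grid_cell N k)"
      using grid_cell_cover[OF N(1)] B(1) unfolding sets_unit_leb_iff by blast
    then have "prob B = prob (\<Union>k\<le>N. B \<inter> grid_cell N k)" by simp
    also have "\<dots> \<le> (\<Sum>k\<le>N. prob (B \<inter> grid_cell N k))"
      using sets_Int_grid_cell[OF B(1)] by (intro finite_measure_subadditive_finite) auto
    also have "\<dots> = 0" using z by simp
    finally show False using B(2) by simp
  qed
  then obtain k where "prob (B \<inter> grid_cell N k) > 0" by blast
  then show ?thesis
    using sets_Int_grid_cell[OF B(1)] measure_Int_grid_cell_le[OF N(1) B(1)] N(2)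
    by (intro bexI[of _ "B \<inter> grid_cell N k"]) (auto intro: le_less_trans)
qed

text \<open>A null set may remain uncovered, so that parts of measure zero can be dropped.\<close>

definition fine_partition :: "(real \<Rightarrow> real \<Rightarrow> real) \<Rightarrow> real \<Rightarrow> real set set \<Rightarrow> bool" where
  "fine_partition W d \<Q> \<longleftrightarrow> finite \<Q> \<and> disjoint \<Q> \<and> \<Q> \<subseteq> sets unit_leb \<and>
     (\<forall>Q\<in>\<Q>. measure unit_leb Q > 0) \<and> measure unit_leb ({0..1} - \<Union>\<Q>) = 0 \<and>
     (\<forall>Q\<in>\<Q>. \<forall>R\<in>\<Q>. \<forall>x\<in>Q. \<forall>x'\<in>Q. \<forall>y\<in>R. \<forall>y'\<in>R. \<bar>W x y - W x' y'\<bar> \<le> d)"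

lemma is_interval_sets_lebesgue: "is_interval (B :: real set) \<Longrightarrow> B \<in> sets lebesgue"
  by (intro sets_completionI_sets) (simp add: real_interval_borel_measurable)

lemma piecewise_lipschitz_fine_partition:
  assumes W: "piecewise_lipschitz c W" and d: "d > 0"
  shows "\<exists>\<Q>. fine_partition W d \<Q>"
proof -
  interpret prob_space unit_leb by (rule prob_space_unit_leb)
  obtain \<B> where \<B>: "finite \<B>" "partition_on {0..1} \<B>"
      "\<forall>B\<in>\<B>. is_interval B \<and> measure lebesgue B > 0"
      "\<forall>B\<in>\<B>. \<forall>B'\<in>\<B>. \<forall>x\<in>B. \<forall>x'\<in>B. \<forall>y\<in>B'. \<forall>y'\<in>B'. \<bar>W x y - W x' y'\<bar> \<le> c * (\<bar>x - x'\<bar> + \<bar>y - y'\<bar>)"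
    using W unfolding piecewise_lipschitz_def by (elim exE conjE)
  have B: "B \<in> events" if "B \<in> \<B>" for B
    using \<B>(2) that is_interval_sets_lebesgue[of B] \<B>(3) by (auto simp: partition_on_def sets_unit_leb_iff)
  \<comment> \<open>Each coordinate varies by at most \<open>1 / real N\<close> in a cell, whence
    the factor 2. The term \<open>\<bar>c\<bar> + 1\<close> keeps the divisor positive for every
    real \<open>c\<close>.\<close>
  obtain N :: nat where N: "N > 0" "1 / real N < d / (2 * (\<bar>c\<bar> + 1))"
    using d ex_inverse_of_nat_less[of "d / (2 * (\<bar>c\<bar> + 1))"] by (auto simp: inverse_eq_divide)
  define \<R> where "\<R> = (\<lambda>(B, k). B \<inter> grid_cell N k) ` (\<B> \<times> {..N})"
  define \<Q> where "\<Q> = {Q \<in> \<R>. prob Q > 0}"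
  have fin: "finite \<R>" using \<B>(1) by (simp add: \<R>_def)
  have ev: "\<R> \<subseteq> events"
    using B sets_Int_grid_cell by (auto simp: \<R>_def)
  have QE: "\<exists>B k. Q = B \<inter> grid_cell N k \<and> B \<in> \<B>" if "Q \<in> \<Q>" for Q
    using that by (auto simp: \<R>_def \<Q>_def)
  have "fine_partition W d \<Q>"
    unfolding fine_partition_def
  proof (intro conjI ballI)
    show "finite \<Q>" using fin by (simp add: \<Q>_def)
    show "disjoint \<Q>"
    proof (rule disjointI)
      fix Q R assume QR: "Q \<in> \<Q>" "R \<in> \<Q>" "Q \<noteq> R"
      then obtain B k B' k' where *: "Q = B \<inter> grid_cell N k" "R = B' \<inter> grid_cell N k'" "B \<in> \<B>" "B' \<in> \<B>"
        using QE by metis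
      then have "B \<noteq> B' \<or> k \<noteq> k'" using QR by auto
      then show "Q \<inter> R = {}"
      proof
        assume "B \<noteq> B'"
        then have "B \<inter> B' = {}"
          using * disjointD[OF partition_onD2[OF \<B>(2)]] by blast
        then show ?thesis using * by blast
      next
        assume "k \<noteq> k'"
        then show ?thesis using * grid_cell_disjoint[OF N(1), of _ k k'] by blast
      qed
    qed
    show "\<Q> \<subseteq> events" using ev by (auto simp: \<Q>_def)
    show "prob Q > 0" if "Q \<in> \<Q>" for Q using that by (simp add: \<Q>_def)
    \<comment> \<open>An uncovered point lies in a dropped cell, and the finitely many dropped cells
      are null.\<close>
    have "{0..1} - \<Union>\<Q> \<subseteq> \<Union>(\<R> - \<Q>)"
    proof
      fix x assume x: "x \<in> {0..1} - \<Union>\<Q>"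
      obtain k where "k \<le> N" "x \<in> grid_cell N k"
        using grid_cell_cover[OF N(1), of x] x by blast
      moreover obtain B where "B \<in> \<B>" "x \<in> B"
        using partition_onD1[OF \<B>(2)] x by blast
      ultimately have "B \<inter> grid_cell N k \<in> \<R>" "x \<in> B \<inter> grid_cell N k" by (auto simp: \<R>_def)
      then show "x \<in> \<Union>(\<R> - \<Q>)" using x by blast
    qed
    then have "prob ({0..1} - \<Union>\<Q>) \<le> prob (\<Union>(\<R> - \<Q>))"
      using fin ev by (intro finite_measure_mono) (auto intro!: sets.finite_Union)
    also have "\<dots> \<le> (\<Sum>Q\<in>\<R> - \<Q>. prob Q)"
      using finite_measure_subadditive_finite[of "\<R> - \<Q>" "\<lambda>Q. Q"] fin ev by fastforce
    also have "\<dots> = 0"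
      by (intro sum.neutral) (auto simp: \<Q>_def measure_le_0_iff not_less)
    finally show "prob ({0..1} - \<Union>\<Q>) = 0"
      by (simp add: measure_le_0_iff)
  next
    fix Q R x x' y y' assume "Q \<in> \<Q>" "R \<in> \<Q>" and xy: "x \<in> Q" "x' \<in> Q" "y \<in> R" "y' \<in> R"
    then obtain B k B' k' where *: "Q = B \<inter> grid_cell N k" "R = B' \<inter> grid_cell N k'" "B \<in> \<B>" "B' \<in> \<B>"
      using QE by metis
    have in_cells: "x \<in> grid_cell N k" "x' \<in> grid_cell N k" "y \<in> grid_cell N k'" "y' \<in> grid_cell N k'"
      using * xy by auto
    have "\<bar>W x y - W x' y'\<bar> \<le> c * (\<bar>x - x'\<bar> + \<bar>y - y'\<bar>)"
      using \<B>(4) * xy by simp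
    also have "\<dots> \<le> (\<bar>c\<bar> + 1) * (1 / real N + 1 / real N)"
      using grid_cell_diff[OF N(1) in_cells(1,2)] grid_cell_diff[OF N(1) in_cells(3,4)]
      by (intro mult_mono add_mono) auto
    also have "\<dots> = 2 * (\<bar>c\<bar> + 1) * (1 / real N)"
      by simp
    also have "\<dots> \<le> d"
      using N(2) by (simp add: field_simps)
    finally show "\<bar>W x y - W x' y'\<bar> \<le> d" .
  qed
  then show ?thesis by blast
qed

section \<open>Two graphs on the parts that bracket the level sets of a mergeon\<close>

section \<open>Bounds for the mergeon\<close>

text \<open>Here \<open>W\<close> reaches \<open>l\<close> somewhere on the product, in
  \<open>lower_edges\<close> everywhere: the first serves as a necessary and the second as a
  sufficient condition for being joined. On a fine partition an upper edge at \<open>l\<close> is a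
  lower edge at \<open>l - d\<close>.\<close>

definition upper_edges :: "(real \<Rightarrow> real \<Rightarrow> real) \<Rightarrow> real set set \<Rightarrow> real \<Rightarrow> (real set \<times> real set) set" where
  "upper_edges W \<Q> l = {(Q, R). Q \<in> \<Q> \<and> R \<in> \<Q> \<and> (\<exists>x\<in>Q. \<exists>y\<in>R. l \<le> W x y)}"

definition lower_edges :: "(real \<Rightarrow> real \<Rightarrow> real) \<Rightarrow> real set set \<Rightarrow> real \<Rightarrow> (real set \<times> real set) set" where
  "lower_edges W \<Q> l = {(Q, R). Q \<in> \<Q> \<and> R \<in> \<Q> \<and> (\<forall>x\<in>Q. \<forall>y\<in>R. l \<le> W x y)}"

text \<open>No edge leads from the parts reachable from \<open>Q\<close> to the others, so
  \<open>W < l'\<close> there; if \<open>R\<close> were not reached, \<open>A\<close> would be split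
  at level \<open>l'\<close>. Membership in \<open>connected_sets\<close> restricts only levels
  strictly below \<open>l\<close>, which is why \<open>l'\<close> appears.\<close>

lemma connected_set_upper_edges:
  assumes \<Q>: "fine_partition W d \<Q>" and A: "A \<in> connected_sets W l" and l': "l' < l"
    and Q: "Q \<in> \<Q>" "measure unit_leb (A \<inter> Q) > 0" and R: "R \<in> \<Q>" "measure unit_leb (A \<inter> R) > 0"
  shows "(Q, R) \<in> (upper_edges W \<Q> l')\<^sup>+"
proof (rule ccontr)
  assume nR: "(Q, R) \<notin> (upper_edges W \<Q> l')\<^sup>+"
  interpret prob_space unit_leb by (rule prob_space_unit_leb)
  have fin: "finite \<Q>" and disj: "disjoint \<Q>" and ev: "\<Q> \<subseteq> events" and null: "prob ({0..1} - \<Union>\<Q>) = 0"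
    using \<Q> by (auto simp: fine_partition_def)
  have Ae: "A \<in> events" and A01: "A \<subseteq> {0..1}" and nd: "\<not> disconnected_at W l' A" and Apos: "prob A > 0"
    using A l' by (auto simp: connected_sets_def sets_unit_leb_iff)
  have "\<Union>\<Q> \<in> events"
    using fin ev by auto
  then have UQ: "{0..1} - \<Union>\<Q> \<in> events"
    using sets.compl_sets by force
  \<comment> \<open>Paths are nonempty, so \<open>Q\<close> belongs to \<open>T\<close> only if some
    path returns to it, and \<open>A \<inter> \<Union>T\<close> can be null.\<close>
  define T where "T = {P \<in> \<Q>. (Q, P) \<in> (upper_edges W \<Q> l')\<^sup>+}"
  have TQ: "T \<subseteq> \<Q>" by (auto simp: T_def)
  have UT: "\<Union>T \<in> events"
    using TQ fin ev by (intro sets.finite_Union) (auto intro: finite_subset)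
  define S where "S = A \<inter> \<Union>T"
  have Se: "S \<in> events" unfolding S_def using Ae UT by auto
  show False
  proof (cases "prob S > 0")
    case True
    have "AE (x, y) in square_leb. x \<in> S \<and> y \<in> A - S \<longrightarrow> W x y < l'"
      using AE_square_leb_snd[OF UQ null]
    proof eventually_elim
      case (elim p)
      obtain x y where p: "p = (x, y)" by (cases p)
      have "W x y < l'" if xy: "x \<in> S" "y \<in> A - S"
      proof (rule ccontr)
        assume *: "\<not> ?thesis"
        obtain P where P: "P \<in> T" "x \<in> P" using xy by (auto simp: S_def)
        obtain P' where P': "P' \<in> \<Q>" "y \<in> P'" using elim xy A01 unfolding p by auto
        have "(P, P') \<in> upper_edges W \<Q> l'"
          using P P' TQ * unfolding upper_edges_def by force
        then have "P' \<in> T"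
          using P P' unfolding T_def by (auto intro: trancl_into_trancl)
        then show False using P' xy by (auto simp: S_def)
      qed
      then show ?case by (simp add: p)
    qed
    moreover have "prob S < prob A"
    proof -
      have "R \<notin> T" using nR by (simp add: T_def)
      then have "P \<inter> R = {}" if "P \<in> T" for P
        using disjointD[OF disj, of P R] TQ R(1) that by blast
      then have "A \<inter> R \<subseteq> A - S"
        unfolding S_def by blast
      then have "prob (A \<inter> R) \<le> prob (A - S)"
        using Ae Se by (intro finite_measure_mono) auto
      also have "\<dots> = prob A - prob S"
        using Ae Se by (intro finite_measure_Diff) (auto simp: S_def)
      finally show ?thesis using R(2) by simp
    qed
    ultimately have "disconnected_at W l' A"
      unfolding disconnected_at_def using True Se by (intro bexI[of _ S]) (auto simp: S_def)
    then show False using nd by simp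
  next
    \<comment> \<open>Here \<open>A\<close> meets no neighbour of \<open>Q\<close>, not even \<open>Q\<close> itself, and any small piece of \<open>A \<inter> Q\<close>
        disconnects \<open>A\<close>; this covers the case \<open>Q = R\<close>.\<close>
    case False
    then have S0: "prob S = 0"
      using measure_nonneg[of unit_leb S] by linarith
    have "A \<inter> Q \<in> events" using Ae ev Q(1) by auto
    then obtain S' where S': "S' \<in> events" "S' \<subseteq> A \<inter> Q" "0 < prob S'" "prob S' < prob A"
      using small_subset[OF _ Q(2) Apos] by blast
    have "AE (x, y) in square_leb. x \<in> S' \<and> y \<in> A - S' \<longrightarrow> W x y < l'"
      using AE_square_leb_snd[OF UQ null] AE_square_leb_snd[OF Se S0]
    proof eventually_elim
      case (elim p)
      obtain x y where p: "p = (x, y)" by (cases p)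
      have "W x y < l'" if xy: "x \<in> S'" "y \<in> A - S'"
      proof (rule ccontr)
        assume *: "\<not> ?thesis"
        obtain P' where P': "P' \<in> \<Q>" "y \<in> P'" using elim(1) xy A01 unfolding p by auto
        have "(Q, P') \<in> upper_edges W \<Q> l'"
          using P' Q(1) xy S' * unfolding upper_edges_def by force
        then have "P' \<in> T"
          using P' unfolding T_def by auto
        then show False using P' xy elim(2) unfolding p by (auto simp: S_def)
      qed
      then show ?case by (simp add: p)
    qed
    then have "disconnected_at W l' A"
      unfolding disconnected_at_def using S' by (intro bexI[of _ S']) auto
    then show False using nd by simp
  qed
qed

text \<open>If \<open>Q\<close> and \<open>R\<close> are not joined, each representative
  \<open>r C\<close> meets one of them in a null set, and a rectangle with a null side is null.
  Countably many clusters and finitely many parts keep the union of the exceptions null.\<close>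

lemma mergeon_upper_edges:
  assumes M: "mergeon W M" and \<Q>: "fine_partition W d \<Q>" and l: "l \<in> {0..1}" "l' < l"
  shows "AE (x, y) in square_leb. l \<le> M x y \<longrightarrow>
           (\<forall>Q\<in>\<Q>. \<forall>R\<in>\<Q>. x \<in> Q \<longrightarrow> y \<in> R \<longrightarrow> (Q, R) \<in> (upper_edges W \<Q> l')\<^sup>+)"
proof -
  have fin: "finite \<Q>" and ev: "\<Q> \<subseteq> sets unit_leb"
    using \<Q> by (auto simp: fine_partition_def)
  obtain r where r: "\<forall>C\<in>clusters W l. r C \<in> C"
    and AE: "AE (x, y) in square_leb. M x y \<ge> l \<longleftrightarrow> (x, y) \<in> (\<Union>C\<in>clusters W l. r C \<times> r C)"
    using M l(1) unfolding mergeon_def by blast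
  have *: "AE (x, y) in square_leb. (Q, R) \<in> (upper_edges W \<Q> l')\<^sup>+ \<or> \<not> (x \<in> r C \<inter> Q \<and> y \<in> r C \<inter> R)"
    if C: "C \<in> clusters W l" and Q: "Q \<in> \<Q>" and R: "R \<in> \<Q>" for C Q R
  proof (cases "(Q, R) \<in> (upper_edges W \<Q> l')\<^sup>+")
    case False
    have A: "r C \<in> connected_sets W l"
      using mem_clusterD(1)[OF C] r C by blast
    then have "r C \<inter> Q \<in> sets unit_leb" "r C \<inter> R \<in> sets unit_leb"
      using ev Q R by (auto simp: connected_sets_def)
    moreover have "measure unit_leb (r C \<inter> Q) = 0 \<or> measure unit_leb (r C \<inter> R) = 0"
      using connected_set_upper_edges[OF \<Q> A l(2) Q _ R] False
      by (auto simp: zero_less_measure_iff)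
    ultimately have "AE (x, y) in square_leb. \<not> (x \<in> r C \<inter> Q \<and> y \<in> r C \<inter> R)"
      by (simp only: null_rectangle_iff)
    then show ?thesis
      by eventually_elim auto
  qed simp
  have "AE p in square_leb. \<forall>C\<in>clusters W l. \<forall>Q\<in>\<Q>. \<forall>R\<in>\<Q>.
      (case p of (x, y) \<Rightarrow> (Q, R) \<in> (upper_edges W \<Q> l')\<^sup>+ \<or> \<not> (x \<in> r C \<inter> Q \<and> y \<in> r C \<inter> R))"
    unfolding AE_ball_countable[OF countable_clusters[OF r]] AE_ball_countable[OF countable_finite[OF fin]]
    using * by blast
  then show ?thesis
    using AE by eventually_elim auto
qed

lemma lower_edges_sym:
  assumes "graphon W" "\<Q> \<subseteq> sets unit_leb" "(Q, R) \<in> lower_edges W \<Q> l"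
  shows "(R, Q) \<in> lower_edges W \<Q> l"
proof -
  have "W y x = W x y" if "x \<in> Q" "y \<in> R" for x y
  proof -
    have "x \<in> {0..1}" "y \<in> {0..1}"
      using assms(2,3) that sets_unit_leb_iff[of Q] sets_unit_leb_iff[of R] unfolding lower_edges_def by auto
    then show ?thesis using assms(1) by (simp add: graphon_def)
  qed
  then have "W y x \<ge> l" if "x \<in> Q" "y \<in> R" for x y
    using assms(3) that by (auto simp: lower_edges_def)
  then show ?thesis
    using assms(3) unfolding lower_edges_def by blast
qed

text \<open>If \<open>S\<close> has positive mass in a part, it must fill every neighbour up to a
  null set, as \<open>W\<close> is large on their product. This spreads through the component of
  \<open>Q\<close>, so \<open>S\<close> fills all of it and separates nothing.\<close>

lemma lower_edges_connected_set:
  assumes W: "graphon W" and \<Q>: "fine_partition W d \<Q>" and QR: "(Q, R) \<in> (lower_edges W \<Q> l)\<^sup>+"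
  shows "\<exists>A\<in>connected_sets W l. Q \<union> R \<subseteq> A"
proof -
  interpret prob_space unit_leb by (rule prob_space_unit_leb)
  let ?E = "lower_edges W \<Q> l"
  have fin: "finite \<Q>" and ev: "\<Q> \<subseteq> events" and pos: "\<And>P. P \<in> \<Q> \<Longrightarrow> prob P > 0"
    using \<Q> by (auto simp: fine_partition_def)
  have sym: "(P, P') \<in> ?E \<Longrightarrow> (P', P) \<in> ?E" for P P'
    using lower_edges_sym[OF W ev] .
  have EQ: "(P, P') \<in> ?E \<Longrightarrow> P \<in> \<Q> \<and> P' \<in> \<Q>" for P P'
    by (auto simp: lower_edges_def)
  define T where "T = {P. (Q, P) \<in> ?E\<^sup>*}"
  \<comment> \<open>The nonempty path gives \<open>Q\<close> a neighbour; hence every part of the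
    component has one, possibly itself.\<close>
  obtain Q' where Q': "(Q, Q') \<in> ?E"
    using QR by (meson tranclD)
  have TQ: "P \<in> \<Q> \<and> (\<exists>P'\<in>T. (P, P') \<in> ?E)" if "P \<in> T" for P
  proof -
    have "(Q, P) \<in> ?E\<^sup>*" using that by (simp add: T_def)
    then show ?thesis
    proof (cases rule: rtranclE)
      case base
      then show ?thesis using Q' EQ unfolding T_def by blast
    next
      case (step P')
      then show ?thesis using sym EQ unfolding T_def by blast
    qed
  qed
  have T_step: "P' \<in> T" if "P \<in> T" "(P, P') \<in> ?E" for P P'
    using that unfolding T_def by (auto intro: rtrancl_into_rtrancl)
  define A where "A = \<Union>T"
  have finT: "finite T" "T \<subseteq> events"
    using TQ fin ev by (auto intro: finite_subset)
  then have Ae: "A \<in> events" unfolding A_def by (intro sets.finite_Union) auto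
  have QT: "Q \<in> T" "R \<in> T"
    using QR unfolding T_def by (auto intro: trancl_into_rtrancl)
  have Apos: "prob A > 0"
  proof -
    have "prob Q \<le> prob A"
      using Ae QT by (intro finite_measure_mono) (auto simp: A_def)
    then show ?thesis using pos TQ[OF QT(1)] by fastforce
  qed
  have "\<not> disconnected_at W l' A" if "l' < l" for l'
  proof
    assume "disconnected_at W l' A"
    then obtain S where S: "S \<in> events" "S \<subseteq> A" "0 < prob S" "prob S < prob A"
      and AE: "AE (x, y) in square_leb. x \<in> S \<and> y \<in> A - S \<longrightarrow> W x y < l'"
      unfolding disconnected_at_def by blast
    have full: "prob (P' - S) = 0" if P: "P \<in> T" "prob (P \<inter> S) > 0" "(P, P') \<in> ?E" for P P'
    proof -
      have "P \<inter> S \<in> events" "P' - S \<in> events" "P' \<subseteq> A"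
        using P(1) S(1) finT T_step[OF P(1,3)] unfolding A_def by auto
      moreover have "l' \<le> W x y" if "x \<in> P" "y \<in> P'" for x y
        using P(3) that \<open>l' < l\<close> unfolding lower_edges_def by fastforce
      ultimately show ?thesis
        using null_of_AE_less[OF AE, of "P \<inter> S" "P' - S"] P(2) by auto
    qed
    have step: "prob (P' \<inter> S) > 0" if P: "P \<in> T" "prob (P \<inter> S) > 0" "(P, P') \<in> ?E" for P P'
    proof -
      have "P' \<in> events" using T_step[OF P(1,3)] finT by auto
      then have "prob P' = prob (P' \<inter> S)"
        using full[OF P] finite_measure_Diff'[of P' S] S(1) by simp
      then show ?thesis using pos EQ[OF P(3)] by fastforce
    qed
    obtain P0 where P0: "P0 \<in> T" "prob (P0 \<inter> S) > 0"
    proof (rule ccontr)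
      assume "\<not> thesis"
      then have z: "prob (P \<inter> S) = 0" if "P \<in> T" for P
        using that \<open>\<And>P. P \<in> T \<Longrightarrow> 0 < prob (P \<inter> S) \<Longrightarrow> thesis\<close> by (meson measure_le_0_iff not_le)
      have "S = (\<Union>P\<in>T. P \<inter> S)" using S(2) by (auto simp: A_def)
      then have "prob S \<le> (\<Sum>P\<in>T. prob (P \<inter> S))"
        using finite_measure_subadditive_finite[of T "\<lambda>P. P \<inter> S"] finT S(1) by fastforce
      then show False using z S(3) by simp
    qed
    have "(P0, P) \<in> ?E\<^sup>*" if "P \<in> T" for P
    proof -
      have "sym ?E" using sym by (auto simp: sym_def)
      then have "(P0, Q) \<in> ?E\<^sup>*"
        using P0(1) unfolding T_def by (auto dest: symD[OF sym_rtrancl])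
      then show ?thesis using that unfolding T_def by auto
    qed
    moreover have "P \<in> T \<and> prob (P \<inter> S) > 0" if "(P0, P) \<in> ?E\<^sup>*" for P
      using that by induction (use P0 step T_step in blast)+
    ultimately have all: "prob (P \<inter> S) > 0" if "P \<in> T" for P
      using that by blast
    \<comment> \<open>A neighbour of \<open>P\<close> has positive mass in \<open>S\<close>, and by
      symmetry its edge leads back to \<open>P\<close>, which is therefore filled.\<close>
    have "prob (P - S) = 0" if "P \<in> T" for P
      using TQ[OF that] sym full all by blast
    moreover have "A - S = (\<Union>P\<in>T. P - S)" by (auto simp: A_def)
    then have "prob (A - S) \<le> (\<Sum>P\<in>T. prob (P - S))"
      using finite_measure_subadditive_finite[of T "\<lambda>P. P - S"] finT S(1) by fastforce
    ultimately have "prob (A - S) \<le> 0" by simp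
    then show False
      using finite_measure_Diff[OF Ae S(1,2)] S(4) by simp
  qed
  then have "A \<in> connected_sets W l"
    using Ae Apos by (simp add: connected_sets_def)
  then show ?thesis
    using QT by (intro bexI[of _ A]) (auto simp: A_def)
qed

text \<open>A connected set containing both parts lies in some \<open>r C\<close> up to a null set,
  so almost all of \<open>Q \<times> R\<close> lies in \<open>r C \<times> r C\<close>.\<close>

lemma mergeon_lower_edges:
  assumes W: "graphon W" and M: "mergeon W M" and \<Q>: "fine_partition W d \<Q>" and l: "l \<in> {0..1}"
  shows "AE (x, y) in square_leb. \<forall>Q\<in>\<Q>. \<forall>R\<in>\<Q>.
           x \<in> Q \<longrightarrow> y \<in> R \<longrightarrow> (Q, R) \<in> (lower_edges W \<Q> l)\<^sup>+ \<longrightarrow> l \<le> M x y"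
proof -
  have fin: "finite \<Q>" and ev: "\<Q> \<subseteq> sets unit_leb"
    using \<Q> by (auto simp: fine_partition_def)
  obtain r where r: "\<forall>C\<in>clusters W l. r C \<in> C"
    and AE: "AE (x, y) in square_leb. M x y \<ge> l \<longleftrightarrow> (x, y) \<in> (\<Union>C\<in>clusters W l. r C \<times> r C)"
    using M l(1) unfolding mergeon_def by blast
  have *: "AE (x, y) in square_leb. x \<in> Q \<longrightarrow> y \<in> R \<longrightarrow> (Q, R) \<in> (lower_edges W \<Q> l)\<^sup>+ \<longrightarrow> l \<le> M x y"
    if Q: "Q \<in> \<Q>" and R: "R \<in> \<Q>" for Q R
  proof (cases "(Q, R) \<in> (lower_edges W \<Q> l)\<^sup>+")
    case True
    obtain A where A: "A \<in> connected_sets W l" "Q \<union> R \<subseteq> A"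
      using lower_edges_connected_set[OF W \<Q> True] by blast
    obtain C where C: "C \<in> clusters W l" "measure unit_leb (A - r C) = 0"
      using connected_set_in_cluster[OF r A(1)] by blast
    have "r C \<in> connected_sets W l"
      using mem_clusterD(1)[OF C(1)] r C(1) by blast
    then have N: "A - r C \<in> sets unit_leb"
      using A by (auto simp: connected_sets_def)
    have 1: "AE (x, y) in square_leb. \<not> (x \<in> A - r C \<and> y \<in> {0..1})"
      by (subst null_rectangle_iff) (use N C(2) in \<open>auto simp: sets_unit_leb_iff\<close>)
    show ?thesis
      using 1 AE AE_square_leb_snd[OF N C(2)] AE_square_leb_unit
      by eventually_elim (use A C(1) in auto)
  qed simp
  have "AE p in square_leb. \<forall>Q\<in>\<Q>. \<forall>R\<in>\<Q>.
      (case p of (x, y) \<Rightarrow> x \<in> Q \<longrightarrow> y \<in> R \<longrightarrow> (Q, R) \<in> (lower_edges W \<Q> l)\<^sup>+ \<longrightarrow> l \<le> M x y)"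
    unfolding AE_ball_countable[OF countable_finite[OF fin]]
    using * by blast
  then show ?thesis
    by eventually_elim auto
qed

section \<open>From pairs of labels to pairs of node indices\<close>

section \<open>Merge distortion\<close>

definition offdiag :: "'a set \<Rightarrow> ('a \<times> 'a) set" where
  "offdiag S = {(i, j). i \<in> S \<and> j \<in> S \<and> i \<noteq> j}"

lemma finite_offdiag: "finite S \<Longrightarrow> finite (offdiag S)"
  by (rule finite_subset[of _ "S \<times> S"]) (auto simp: offdiag_def)

text \<open>The default 0 is at most \<open>e\<close>, so it is never what makes the maximum exceed
  \<open>e\<close>.\<close>

lemma Max_offdiag_gt_iff:
  fixes h :: "'a \<Rightarrow> 'a \<Rightarrow> real"
  assumes "finite S" "0 \<le> e"
  shows "Max (insert 0 {h i j | i j. i \<in> S \<and> j \<in> S \<and> i \<noteq> j}) > e \<longleftrightarrow> (\<exists>(i, j)\<in>offdiag S. h i j > e)"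
proof -
  have *: "{h i j | i j. i \<in> S \<and> j \<in> S \<and> i \<noteq> j} = (\<lambda>(i, j). h i j) ` offdiag S"
    by (auto simp: offdiag_def)
  show ?thesis
    unfolding * using assms finite_offdiag[OF assms(1)] by (auto simp: Max_gr_iff case_prod_unfold)
qed

text \<open>Clusters sharing the point \<open>s\<close> are nested, so a minimal one among the
  finitely many that contain both points is least, and \<open>LEAST\<close> is meaningful.\<close>

lemma smallest_cluster:
  assumes C: "clustering S \<C>" and S: "finite S" "s \<in> S" "s' \<in> S"
  shows "smallest_cluster \<C> s s' \<in> \<C>" "s \<in> smallest_cluster \<C> s s'" "s' \<in> smallest_cluster \<C> s s'"
    and "\<And>E. E \<in> \<C> \<Longrightarrow> s \<in> E \<Longrightarrow> s' \<in> E \<Longrightarrow> smallest_cluster \<C> s s' \<subseteq> E"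
proof -
  let ?K = "{E \<in> \<C>. s \<in> E \<and> s' \<in> E}"
  have "finite ?K" "S \<in> ?K"
    using C S by (auto simp: clustering_def intro: finite_subset[of _ "Pow S"])
  then obtain D where D: "D \<in> ?K" "\<And>E. E \<in> ?K \<Longrightarrow> E \<subseteq> D \<Longrightarrow> D = E"
    using finite_has_minimal[of ?K] by blast
  have least: "D \<subseteq> E" if "E \<in> ?K" for E
  proof -
    have "D \<subseteq> E \<or> E \<subseteq> D \<or> D \<inter> E = {}"
      using C D(1) that unfolding clustering_def by blast
    then show ?thesis using D that by blast
  qed
  have "smallest_cluster \<C> s s' = D"
    unfolding smallest_cluster_def by (rule Least_equality) (use D(1) least in auto)
  then show "smallest_cluster \<C> s s' \<in> \<C>" "s \<in> smallest_cluster \<C> s s'" "s' \<in> smallest_cluster \<C> s s'"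
    "\<And>E. E \<in> \<C> \<Longrightarrow> s \<in> E \<Longrightarrow> s' \<in> E \<Longrightarrow> smallest_cluster \<C> s s' \<subseteq> E"
    using D(1) least by auto
qed

lemma smallest_cluster_relabel:
  assumes C: "clustering S \<C>" and S: "finite S" "i \<in> S" "j \<in> S" and x: "inj_on x S"
  shows "smallest_cluster (relabel \<C> x) (x i) (x j) = x ` smallest_cluster \<C> i j"
  unfolding smallest_cluster_def[of "relabel \<C> x"]
proof (rule Least_equality)
  show "x ` smallest_cluster \<C> i j \<in> relabel \<C> x \<and> x i \<in> x ` smallest_cluster \<C> i j \<and>
      x j \<in> x ` smallest_cluster \<C> i j"
    using smallest_cluster(1-3)[OF C S] by (auto simp: relabel_def)
next
  fix F assume "F \<in> relabel \<C> x \<and> x i \<in> F \<and> x j \<in> F"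
  then obtain E where E: "E \<in> \<C>" "F = x ` E" "x i \<in> x ` E" "x j \<in> x ` E"
    by (auto simp: relabel_def)
  have "E \<subseteq> S" using C E(1) by (auto simp: clustering_def)
  then have "i \<in> E" "j \<in> E"
    using E(3,4) x S by (auto simp: inj_on_image_mem_iff)
  then show "x ` smallest_cluster \<C> i j \<subseteq> F"
    using smallest_cluster(4)[OF C S E(1)] E(2) by blast
qed

lemma induced_merge_height_relabel:
  assumes C: "clustering S \<C>" and S: "finite S" "i \<in> S" "j \<in> S" and x: "inj_on x S"
  shows "induced_merge_height M (relabel \<C> x) (x i) (x j) =
    Min ((\<lambda>(u, v). M (x u) (x v)) ` offdiag (smallest_cluster \<C> i j))"
proof -
  let ?D = "smallest_cluster \<C> i j"
  have "?D \<subseteq> S"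
    using smallest_cluster(1)[OF C S] C by (auto simp: clustering_def)
  then have "x u \<noteq> x v \<longleftrightarrow> u \<noteq> v" if "u \<in> ?D" "v \<in> ?D" for u v
    using x that by (auto simp: inj_on_def)
  then have "{M u v | u v. u \<in> x ` ?D \<and> v \<in> x ` ?D \<and> u \<noteq> v} = (\<lambda>(u, v). M (x u) (x v)) ` offdiag ?D"
    unfolding offdiag_def by (auto simp: image_iff)
  then show ?thesis
    unfolding induced_merge_height_def smallest_cluster_relabel[OF assms] by simp
qed

text \<open>The index pairs form a fixed finite set while the label pairs vary with
  \<open>x\<close>; this form serves both the measurability proof and the deterministic
  estimate.\<close>

lemma merge_distortion_relabel_gt_iff:
  assumes C: "clustering S \<C>" and S: "finite S" and x: "inj_on x S" and e: "0 \<le> e"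
  shows "merge_distortion (x ` S) M (induced_merge_height M (relabel \<C> x)) > e \<longleftrightarrow>
    (\<exists>(i, j)\<in>offdiag S. \<bar>M (x i) (x j) -
       Min ((\<lambda>(u, v). M (x u) (x v)) ` offdiag (smallest_cluster \<C> i j))\<bar> > e)"
proof -
  let ?h = "\<lambda>s s'. \<bar>M s s' - induced_merge_height M (relabel \<C> x) s s'\<bar>"
  have "merge_distortion (x ` S) M (induced_merge_height M (relabel \<C> x)) > e \<longleftrightarrow>
      (\<exists>(s, s')\<in>offdiag (x ` S). ?h s s' > e)"
    unfolding merge_distortion_def using S e by (intro Max_offdiag_gt_iff) auto
  also have "offdiag (x ` S) = (\<lambda>(i, j). (x i, x j)) ` offdiag S"
    using x by (auto simp: offdiag_def inj_on_def image_iff)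
  also have "(\<exists>(s, s')\<in>(\<lambda>(i, j). (x i, x j)) ` offdiag S. ?h s s' > e) \<longleftrightarrow>
      (\<exists>(i, j)\<in>offdiag S. ?h (x i) (x j) > e)"
    by (auto simp: case_prod_unfold)
  also have "\<dots> \<longleftrightarrow> (\<exists>(i, j)\<in>offdiag S. \<bar>M (x i) (x j) -
       Min ((\<lambda>(u, v). M (x u) (x v)) ` offdiag (smallest_cluster \<C> i j))\<bar> > e)"
    using induced_merge_height_relabel[OF C S _ _ x]
    by (intro bex_cong) (auto simp: offdiag_def)
  finally show ?thesis .
qed

section \<open>Nesting of threshold components\<close>

section \<open>Single linkage\<close>

lemma threshold_edges_antimono: "l \<le> l' \<Longrightarrow> threshold_edges n P l' \<subseteq> threshold_edges n P l"
  by (auto simp: threshold_edges_def)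

lemma sym_threshold_edges:
  assumes "\<And>i j. i \<in> {1..n} \<Longrightarrow> j \<in> {1..n} \<Longrightarrow> P i j = P j i"
  shows "sym (threshold_edges n P l)"
  using assms by (auto simp: sym_def threshold_edges_def)

lemma component_subset:
  assumes "i \<in> {1..n}" "(i, j) \<in> (threshold_edges n P l)\<^sup>*"
  shows "j \<in> {1..n}"
  using assms(2,1) by induction (auto simp: threshold_edges_def)

text \<open>Lowering the threshold enlarges components, so of two components with a common node the
  one with the higher threshold lies inside the other.\<close>

lemma clustering_single_linkage:
  assumes n: "n \<ge> 1" and P: "\<And>i j. i \<in> {1..n} \<Longrightarrow> j \<in> {1..n} \<Longrightarrow> P i j = P j i"
  shows "clustering {1..n} (single_linkage n P)"
proof -
  let ?E = "threshold_edges n P"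
  have sym: "sym ((?E l)\<^sup>*)" for l
    by (rule sym_rtrancl[OF sym_threshold_edges[OF P]])
  have nested: "(?E l)\<^sup>* `` {i} \<subseteq> (?E l')\<^sup>* `` {j}"
    if "l' \<le> l" "k \<in> (?E l)\<^sup>* `` {i}" "k \<in> (?E l')\<^sup>* `` {j}" for l l' i j k
  proof
    fix m assume m: "m \<in> (?E l)\<^sup>* `` {i}"
    have "(k, i) \<in> (?E l)\<^sup>*" "(i, m) \<in> (?E l)\<^sup>*"
      using m that(2) symD[OF sym] by auto
    then have "(k, m) \<in> (?E l)\<^sup>*" by (rule rtrancl_trans)
    then have "(k, m) \<in> (?E l')\<^sup>*"
      using rtrancl_mono[OF threshold_edges_antimono[OF that(1)]] by blast
    then show "m \<in> (?E l')\<^sup>* `` {j}"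
      using that(3) by (auto intro: rtrancl_trans)
  qed
  have "A \<subseteq> B \<or> B \<subseteq> A \<or> A \<inter> B = {}" if A: "A \<in> single_linkage n P" and B: "B \<in> single_linkage n P" for A B
  proof -
    obtain l i where lA: "A = (?E l)\<^sup>* `` {i}"
      using A by (auto simp: single_linkage_def quotient_def)
    obtain l' j where lB: "B = (?E l')\<^sup>* `` {j}"
      using B by (auto simp: single_linkage_def quotient_def)
    show ?thesis
    proof (cases "A \<inter> B = {}")
      case False
      then obtain k where k: "k \<in> A" "k \<in> B" by blast
      show ?thesis
        using nested[of l' l k i j] nested[of l l' k j i] k unfolding lA lB by (cases "l \<le> l'") auto
    qed simp
  qed
  moreover have "{1..n} \<in> single_linkage n P"
  proof -
    \<comment> \<open>Including the diagonal keeps the set nonempty for \<open>n = 1\<close>; at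
      this level node 1 is adjacent to all other nodes.\<close>
    define l where "l = Min ((\<lambda>(i, j). P i j) ` ({1..n} \<times> {1..n}))"
    have l: "l \<le> P i j" if "i \<in> {1..n}" "j \<in> {1..n}" for i j
      unfolding l_def using that by (intro Min_le) auto
    have 1: "1 \<in> {1..n}" using n by simp
    have "(1, j) \<in> (?E l)\<^sup>*" if "j \<in> {1..n}" for j
      using l[OF 1 that] 1 that by (cases "j = 1") (auto simp: threshold_edges_def)
    then have "(?E l)\<^sup>* `` {1} = {1..n}"
      using component_subset[OF 1] by blast
    then show ?thesis
      using 1 unfolding single_linkage_def quotient_def by blast
  qed
  moreover have "single_linkage n P \<subseteq> Pow {1..n}"
  proof
    fix A assume "A \<in> single_linkage n P"
    then obtain l i where "i \<in> {1..n}" "A = (?E l)\<^sup>* `` {i}"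
      by (auto simp: single_linkage_def quotient_def)
    then show "A \<in> Pow {1..n}"
      using component_subset[of i n] by blast
  qed
  ultimately show ?thesis
    unfolding clustering_def by blast
qed

text \<open>The component of \<open>i\<close> at level \<open>l\<close> is itself a cluster
  containing both nodes, so the smallest such cluster lies inside it.\<close>

lemma smallest_single_linkage_cluster_connected:
  assumes P: "\<And>i j. i \<in> {1..n} \<Longrightarrow> j \<in> {1..n} \<Longrightarrow> P i j = P j i"
    and ij: "i \<in> {1..n}" "j \<in> {1..n}" "(i, j) \<in> (threshold_edges n P l)\<^sup>*"
    and uv: "u \<in> smallest_cluster (single_linkage n P) i j" "v \<in> smallest_cluster (single_linkage n P) i j"
  shows "(u, v) \<in> (threshold_edges n P l)\<^sup>*"
proof -
  let ?K = "(threshold_edges n P l)\<^sup>* `` {i}"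
  have C: "clustering {1..n} (single_linkage n P)"
    using ij by (intro clustering_single_linkage[OF _ P]) auto
  have "?K \<in> single_linkage n P"
    using ij(1) unfolding single_linkage_def quotient_def by blast
  then have "smallest_cluster (single_linkage n P) i j \<subseteq> ?K"
    using ij by (intro smallest_cluster(4)[OF C]) auto
  then have "(i, u) \<in> (threshold_edges n P l)\<^sup>*" "(i, v) \<in> (threshold_edges n P l)\<^sup>*"
    using uv by auto
  then show ?thesis
    using symD[OF sym_rtrancl[OF sym_threshold_edges[of n P l, OF P]]] by (blast intro: rtrancl_trans)
qed

section \<open>Deterministic transfer between paths of parts and threshold paths\<close>

section \<open>Labels which hit every part\<close>

text \<open>Labels hitting the intermediate parts form the path. One \<open>d\<close> pays for
  moving inside the two parts, the other for the estimate. The closure is reflexive because an edge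
  from a part to itself may start and end at the same label.\<close>

lemma upper_path_threshold_path:
  assumes \<Q>: "fine_partition W d \<Q>"
    and hit: "\<And>Q. Q \<in> \<Q> \<Longrightarrow> \<exists>i\<in>{1..n}. x i \<in> Q"
    and close: "\<And>i j. i \<in> {1..n} \<Longrightarrow> j \<in> {1..n} \<Longrightarrow> i \<noteq> j \<Longrightarrow> \<bar>W (x i) (x j) - P i j\<bar> \<le> d"
    and path: "(Q, R) \<in> (upper_edges W \<Q> l)\<^sup>+"
    and i: "i \<in> {1..n}" "x i \<in> Q" and j: "j \<in> {1..n}" "x j \<in> R"
  shows "(i, j) \<in> (threshold_edges n P (l - 2 * d))\<^sup>*"
proof -
  have edge: "(i, j) \<in> (threshold_edges n P (l - 2 * d))\<^sup>*"
    if "(Q, R) \<in> upper_edges W \<Q> l" "i \<in> {1..n}" "x i \<in> Q" "j \<in> {1..n}" "x j \<in> R" for Q R i j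
  proof (cases "i = j")
    case False
    obtain y z where yz: "Q \<in> \<Q>" "R \<in> \<Q>" "y \<in> Q" "z \<in> R" "l \<le> W y z"
      using \<open>(Q, R) \<in> upper_edges W \<Q> l\<close> by (auto simp: upper_edges_def)
    then have "\<bar>W y z - W (x i) (x j)\<bar> \<le> d"
      using \<Q> that unfolding fine_partition_def by blast
    then have "l - 2 * d \<le> P i j"
      using close[OF that(2,4) False] yz by linarith
    then show ?thesis
      using False that by (auto simp: threshold_edges_def)
  qed simp
  show ?thesis
    using path j
  proof (induction arbitrary: j)
    case (base R)
    then show ?case using edge i by blast
  next
    case (step R R')
    have "R \<in> \<Q>" using step.hyps(2) by (auto simp: upper_edges_def)
    then obtain k where k: "k \<in> {1..n}" "x k \<in> R" using hit by blast
    show ?case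
      using step.IH[OF k] edge[OF step.hyps(2) k step.prems] by (rule rtrancl_trans)
  qed
qed

text \<open>Each label on the path names its part by \<open>cover\<close>, and the same two errors
  make every step an edge valid on the whole product. The path stays nonempty, as the construction
  of connected sets requires.\<close>

lemma threshold_path_lower_path:
  assumes \<Q>: "fine_partition W d \<Q>"
    and cover: "\<And>i. i \<in> {1..n} \<Longrightarrow> x i \<in> \<Union>\<Q>"
    and close: "\<And>i j. i \<in> {1..n} \<Longrightarrow> j \<in> {1..n} \<Longrightarrow> i \<noteq> j \<Longrightarrow> \<bar>W (x i) (x j) - P i j\<bar> \<le> d"
    and path: "(i, j) \<in> (threshold_edges n P l)\<^sup>+"
    and Q: "Q \<in> \<Q>" "x i \<in> Q" and R: "R \<in> \<Q>" "x j \<in> R"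
  shows "(Q, R) \<in> (lower_edges W \<Q> (l - 2 * d))\<^sup>+"
proof -
  have edge: "(Q, R) \<in> lower_edges W \<Q> (l - 2 * d)"
    if "(i, j) \<in> threshold_edges n P l" "Q \<in> \<Q>" "x i \<in> Q" "R \<in> \<Q>" "x j \<in> R" for Q R i j
  proof -
    have ij: "i \<in> {1..n}" "j \<in> {1..n}" "i \<noteq> j" "l \<le> P i j"
      using that(1) by (auto simp: threshold_edges_def)
    have "l - 2 * d \<le> W y z" if yz: "y \<in> Q" "z \<in> R" for y z
    proof -
      have "\<bar>W (x i) (x j) - W y z\<bar> \<le> d"
        using \<Q> \<open>Q \<in> \<Q>\<close> \<open>R \<in> \<Q>\<close> \<open>x i \<in> Q\<close> \<open>x j \<in> R\<close> yz unfolding fine_partition_def by blast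
      then show ?thesis
        using close[OF ij(1-3)] ij(4) by linarith
    qed
    then show ?thesis
      using that by (auto simp: lower_edges_def)
  qed
  show ?thesis
    using path R
  proof (induction arbitrary: R)
    case (base j)
    then show ?case using edge Q by blast
  next
    case (step j k)
    have "j \<in> {1..n}" using step.hyps(2) by (auto simp: threshold_edges_def)
    then obtain R' where R': "R' \<in> \<Q>" "x j \<in> R'" using cover by blast
    show ?case
      using step.IH[OF R'] edge[OF step.hyps(2) R' step.prems] by (rule trancl_into_trancl)
  qed
qed

text \<open>Parts have positive measure, so an edge would exhibit a value of \<open>W\<close> above
  1. This keeps rounded levels in the range where a mergeon is specified.\<close>

lemma lower_edges_empty:
  assumes "graphon W" "fine_partition W d \<Q>" "l > 1"
  shows "lower_edges W \<Q> l = {}"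
proof (rule ccontr)
  assume "\<not> ?thesis"
  then obtain Q R where QR: "Q \<in> \<Q>" "R \<in> \<Q>" "\<forall>x\<in>Q. \<forall>y\<in>R. l \<le> W x y"
    by (auto simp: lower_edges_def)
  have "Q \<noteq> {}" "R \<noteq> {}" "Q \<subseteq> {0..1}" "R \<subseteq> {0..1}"
    using assms(2) QR(1,2) by (auto simp: fine_partition_def subset_eq sets_unit_leb_iff)
  then obtain x y where "x \<in> Q" "y \<in> R" "x \<in> {0..1}" "y \<in> {0..1}" by blast
  then have "l \<le> W x y" "W x y \<le> 1"
    using QR(3) assms(1) by (auto simp: graphon_def)
  then show False using assms(3) by linarith
qed

text \<open>Membership in a cluster is only controlled almost everywhere, and the exceptional null set
  depends on the level, so levels are restricted to multiples of \<open>d\<close>.\<close>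

definition typical_pair ::
    "(real \<Rightarrow> real \<Rightarrow> real) \<Rightarrow> (real \<Rightarrow> real \<Rightarrow> real) \<Rightarrow> real \<Rightarrow> real set set \<Rightarrow> real \<Rightarrow> real \<Rightarrow> bool" where
  "typical_pair W M d \<Q> y z \<longleftrightarrow> (\<forall>k::nat. real k * d \<in> {0..1} \<longrightarrow> (\<forall>Q\<in>\<Q>. \<forall>R\<in>\<Q>. y \<in> Q \<longrightarrow> z \<in> R \<longrightarrow>
     (real k * d \<le> M y z \<longrightarrow> (Q, R) \<in> (upper_edges W \<Q> (real k * d - d))\<^sup>+) \<and>
     ((Q, R) \<in> (lower_edges W \<Q> (real k * d))\<^sup>+ \<longrightarrow> real k * d \<le> M y z)))"

lemma AE_typical_pair:
  assumes W: "graphon W" and M: "mergeon W M" and \<Q>: "fine_partition W d \<Q>" and d: "d > 0"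
  shows "AE (y, z) in square_leb. typical_pair W M d \<Q> y z"
proof -
  have "AE p in square_leb. real k * d \<in> {0..1} \<longrightarrow> (\<forall>Q\<in>\<Q>. \<forall>R\<in>\<Q>. fst p \<in> Q \<longrightarrow> snd p \<in> R \<longrightarrow>
     (real k * d \<le> M (fst p) (snd p) \<longrightarrow> (Q, R) \<in> (upper_edges W \<Q> (real k * d - d))\<^sup>+) \<and>
     ((Q, R) \<in> (lower_edges W \<Q> (real k * d))\<^sup>+ \<longrightarrow> real k * d \<le> M (fst p) (snd p)))" for k :: nat
  proof (cases "real k * d \<in> {0..1}")
    case True
    \<comment> \<open>The bound by upper paths needs a strictly smaller level; the gap
      \<open>d\<close> chosen here is one of the four in \<open>4 * d\<close>.\<close>
    have "real k * d - d < real k * d" using d by simp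
    from mergeon_upper_edges[OF M \<Q> True this] mergeon_lower_edges[OF W M \<Q> True]
    show ?thesis
      by eventually_elim (simp add: case_prod_unfold)
  next
    case False
    then show ?thesis by (intro AE_I2) blast
  qed
  then show ?thesis
    unfolding typical_pair_def case_prod_unfold by (subst AE_all_countable) blast
qed

text \<open>Collects what holds almost surely; hitting all parts and accuracy of the estimate hold
  only with high probability and stay separate.\<close>

definition typical_labels ::
    "(real \<Rightarrow> real \<Rightarrow> real) \<Rightarrow> (real \<Rightarrow> real \<Rightarrow> real) \<Rightarrow> real \<Rightarrow> real set set \<Rightarrow> nat \<Rightarrow> (nat \<Rightarrow> real) \<Rightarrow> bool" where
  "typical_labels W M d \<Q> n x \<longleftrightarrow> inj_on x {1..n} \<and> (\<forall>i\<in>{1..n}. x i \<in> \<Union>\<Q>) \<and>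
     (\<forall>p\<in>offdiag {1..n}. typical_pair W M d \<Q> (x (fst p)) (x (snd p)))"

lemma AE_typical_labels:
  assumes W: "graphon W" and M: "mergeon W M" and \<Q>: "fine_partition W d \<Q>" and d: "d > 0"
  shows "AE x in labels n. typical_labels W M d \<Q> n x"
proof -
  have fin: "finite \<Q>" and ev: "\<Q> \<subseteq> sets unit_leb" and null: "measure unit_leb ({0..1} - \<Union>\<Q>) = 0"
    using \<Q> by (auto simp: fine_partition_def)
  have cover: "AE x in labels n. \<forall>i\<in>{1..n}. x i \<in> \<Union>\<Q>"
  proof -
    interpret prob_space unit_leb by (rule prob_space_unit_leb)
    have "\<Union>\<Q> \<in> events"
      using fin ev by auto
    then have "{0..1} - \<Union>\<Q> \<in> events"
      using sets.compl_sets by force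
    then have "{0..1} - \<Union>\<Q> \<in> null_sets unit_leb"
      using null by (intro null_setsI) (simp_all add: emeasure_eq_measure)
    then have "AE y in unit_leb. y \<notin> {0..1} - \<Union>\<Q>"
      by (rule AE_not_in)
    then have "AE y in unit_leb. y \<in> \<Union>\<Q>"
      using AE_space[of unit_leb] by eventually_elim simp
    then have "AE x in labels n. x i \<in> \<Union>\<Q>" if "i \<in> {1..n}" for i
      unfolding labels_def using that by (intro AE_label_component)
    then show ?thesis
      by (intro eventually_ball_finite) auto
  qed
  have pairs: "AE x in labels n. \<forall>p\<in>offdiag {1..n}. typical_pair W M d \<Q> (x (fst p)) (x (snd p))"
  proof (intro eventually_ball_finite ballI)
    show "finite (offdiag {1..n})" by (simp add: finite_offdiag)
    fix p assume "p \<in> offdiag {1..n}"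
    then have "fst p \<in> {1..n}" "snd p \<in> {1..n}" "fst p \<noteq> snd p"
      by (auto simp: offdiag_def)
    then show "AE x in labels n. typical_pair W M d \<Q> (x (fst p)) (x (snd p))"
      unfolding labels_def by (rule AE_label_pair[OF finite_atLeastAtMost _ _ _ AE_typical_pair[OF assms]])
  qed
  have inj: "AE x in labels n. inj_on x {1..n}"
    unfolding labels_def by (rule AE_labels_inj) simp
  show ?thesis
    using inj cover pairs by eventually_elim (simp add: typical_labels_def)
qed

text \<open>In \<open>4 * d\<close>, one \<open>d\<close> rounds the height down to a multiple, one
  is the strict drop in level, and \<open>2 * d\<close> turns the path of parts into a threshold
  path. In \<open>3 * d\<close>, the path costs \<open>2 * d\<close> and rounding one
  \<open>d\<close>.\<close>

lemma typical_labels_merge_heights: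
  assumes W: "graphon W" and M: "graphon M" and \<Q>: "fine_partition W d \<Q>" and d: "d > 0"
    and x: "x \<in> space (labels n)" and typical: "typical_labels W M d \<Q> n x"
    and hit: "\<And>Q. Q \<in> \<Q> \<Longrightarrow> \<exists>i\<in>{1..n}. x i \<in> Q"
    and close: "\<And>i j. i \<in> {1..n} \<Longrightarrow> j \<in> {1..n} \<Longrightarrow> i \<noteq> j \<Longrightarrow> \<bar>W (x i) (x j) - P i j\<bar> \<le> d"
    and ij: "i \<in> {1..n}" "j \<in> {1..n}" "i \<noteq> j"
  shows "(i, j) \<in> (threshold_edges n P (M (x i) (x j) - 4 * d))\<^sup>*"
    and "(i, j) \<in> (threshold_edges n P l)\<^sup>* \<Longrightarrow> l - 3 * d \<le> M (x i) (x j)"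
proof -
  have cover: "x i \<in> \<Union>\<Q>" if "i \<in> {1..n}" for i
    using typical that by (auto simp: typical_labels_def)
  have M01: "M (x i) (x j) \<in> {0..1}"
    using M label_in_unit[OF x] ij by (simp add: graphon_def)
  obtain Q R where Q: "Q \<in> \<Q>" "x i \<in> Q" and R: "R \<in> \<Q>" "x j \<in> R"
    using cover ij(1,2) by blast
  have "(i, j) \<in> offdiag {1..n}" using ij by (simp add: offdiag_def)
  then have pair: "typical_pair W M d \<Q> (x i) (x j)"
    using typical by (force simp: typical_labels_def)
  have U: "(Q, R) \<in> (upper_edges W \<Q> (real k * d - d))\<^sup>+"
    if "real k * d \<in> {0..1}" "real k * d \<le> M (x i) (x j)" for k :: nat
    using pair Q R that unfolding typical_pair_def by blast
  have L: "real k * d \<le> M (x i) (x j)"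
    if "real k * d \<in> {0..1}" "(Q, R) \<in> (lower_edges W \<Q> (real k * d))\<^sup>+" for k :: nat
    using pair Q R that unfolding typical_pair_def by blast
  have grid: "\<exists>k::nat. real k * d \<le> t \<and> t < real k * d + d" if "0 \<le> t" for t
  proof
    show "real (nat \<lfloor>t / d\<rfloor>) * d \<le> t \<and> t < real (nat \<lfloor>t / d\<rfloor>) * d + d"
      using that d floor_divide_lower[OF d, of t] floor_divide_upper[OF d, of t] by (simp add: algebra_simps)
  qed
  obtain k :: nat where k: "real k * d \<le> M (x i) (x j)" "M (x i) (x j) < real k * d + d"
    using grid M01 by force
  have "real k * d \<in> {0..1}"
    using k(1) M01 d by auto
  then have "(i, j) \<in> (threshold_edges n P (real k * d - d - 2 * d))\<^sup>*"
    using U k(1) by (intro upper_path_threshold_path[OF \<Q> hit close _ ij(1) Q(2) ij(2) R(2)]) auto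
  moreover have "threshold_edges n P (real k * d - d - 2 * d) \<subseteq> threshold_edges n P (M (x i) (x j) - 4 * d)"
    using k(2) by (intro threshold_edges_antimono) linarith
  ultimately show "(i, j) \<in> (threshold_edges n P (M (x i) (x j) - 4 * d))\<^sup>*"
    using rtrancl_mono by blast
  show "l - 3 * d \<le> M (x i) (x j)" if path: "(i, j) \<in> (threshold_edges n P l)\<^sup>*"
  proof (cases "0 \<le> l - 2 * d")
    case True
    then obtain k :: nat where k: "real k * d \<le> l - 2 * d" "l - 2 * d < real k * d + d"
      using grid by blast
    have path': "(i, j) \<in> (threshold_edges n P l)\<^sup>+"
      using path ij(3) by (auto dest: rtranclD)
    have "(Q, R) \<in> (lower_edges W \<Q> (l - 2 * d))\<^sup>+"
      using \<Q> cover close path' Q R by (rule threshold_path_lower_path)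
    moreover have "lower_edges W \<Q> (l - 2 * d) \<subseteq> lower_edges W \<Q> (real k * d)"
      using k(1) by (auto simp: lower_edges_def intro: order_trans)
    ultimately have lower: "(Q, R) \<in> (lower_edges W \<Q> (real k * d))\<^sup>+"
      by (rule trancl_mono)
    \<comment> \<open>The threshold \<open>l\<close> is an arbitrary real, so the rounded level must
      be shown to be at most 1 before \<open>L\<close> applies.\<close>
    then have "real k * d \<le> 1"
      using lower_edges_empty[OF W \<Q>, of "real k * d"] by (cases "real k * d \<le> 1") auto
    then have "real k * d \<le> M (x i) (x j)"
      using lower d by (intro L) auto
    then show ?thesis using k(2) by linarith
  next
    \<comment> \<open>Here \<open>l - 3 * d\<close> is negative, while the mergeon is
      nonnegative.\<close>
    case False
    then show ?thesis using M01 d by auto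
  qed
qed

text \<open>The pair itself is a candidate, so the minimum cannot exceed its height. Conversely the
  smallest cluster lies in one component at level \<open>M (x i) (x j) - 4 * d\<close>, so every
  pair in it has height at least \<open>3 * d\<close> below that level.\<close>

lemma typical_labels_distortion:
  assumes W: "graphon W" and M: "graphon M" and \<Q>: "fine_partition W d \<Q>" and d: "d > 0"
    and x: "x \<in> space (labels n)" and typical: "typical_labels W M d \<Q> n x"
    and hit: "\<And>Q. Q \<in> \<Q> \<Longrightarrow> \<exists>i\<in>{1..n}. x i \<in> Q"
    and close: "\<And>i j. i \<in> {1..n} \<Longrightarrow> j \<in> {1..n} \<Longrightarrow> i \<noteq> j \<Longrightarrow> \<bar>W (x i) (x j) - P i j\<bar> \<le> d"
    and P: "\<And>i j. i \<in> {1..n} \<Longrightarrow> j \<in> {1..n} \<Longrightarrow> P i j = P j i" and n: "n \<ge> 1"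
  shows "merge_distortion (x ` {1..n}) M (induced_merge_height M (relabel (single_linkage n P) x)) \<le> 7 * d"
proof -
  have height_le: "(i, j) \<in> (threshold_edges n P (M (x i) (x j) - 4 * d))\<^sup>*"
    if "i \<in> {1..n}" "j \<in> {1..n}" "i \<noteq> j" for i j
    using W M \<Q> d x typical hit close that by (rule typical_labels_merge_heights(1))
  have height_ge: "l - 3 * d \<le> M (x i) (x j)"
    if "i \<in> {1..n}" "j \<in> {1..n}" "i \<noteq> j" "(i, j) \<in> (threshold_edges n P l)\<^sup>*" for i j l
    using W M \<Q> d x typical hit close that by (rule typical_labels_merge_heights(2))
  have C: "clustering {1..n} (single_linkage n P)"
    by (rule clustering_single_linkage[OF n P])
  have inj: "inj_on x {1..n}" using typical by (simp add: typical_labels_def)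
  have "\<bar>M (x i) (x j) - Min ((\<lambda>(u, v). M (x u) (x v)) ` offdiag (smallest_cluster (single_linkage n P) i j))\<bar> \<le> 7 * d"
    if ij: "i \<in> {1..n}" "j \<in> {1..n}" "i \<noteq> j" for i j
  proof -
    let ?D = "smallest_cluster (single_linkage n P) i j"
    let ?V = "(\<lambda>(u, v). M (x u) (x v)) ` offdiag ?D"
    note D = smallest_cluster[OF C finite_atLeastAtMost ij(1,2)]
    have Dn: "?D \<subseteq> {1..n}"
      using C D(1) by (auto simp: clustering_def)
    have fin: "finite ?V"
      using Dn by (intro finite_imageI finite_offdiag) (rule finite_subset, auto)
    have mem: "M (x i) (x j) \<in> ?V"
      using D ij(3) by (force simp: offdiag_def)
    have "M (x i) (x j) - 7 * d \<le> M (x u) (x v)" if uv: "u \<in> ?D" "v \<in> ?D" "u \<noteq> v" for u v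
    proof -
      have "(u, v) \<in> (threshold_edges n P (M (x i) (x j) - 4 * d))\<^sup>*"
        using P ij(1,2) height_le[OF ij] uv(1,2) by (rule smallest_single_linkage_cluster_connected)
      then have "M (x i) (x j) - 4 * d - 3 * d \<le> M (x u) (x v)"
        using uv Dn by (intro height_ge) auto
      then show ?thesis by simp
    qed
    then have "M (x i) (x j) - 7 * d \<le> Min ?V"
      using fin mem by (subst Min_ge_iff) (auto simp: offdiag_def)
    moreover have "Min ?V \<le> M (x i) (x j)"
      using fin mem by (rule Min_le)
    ultimately show ?thesis by linarith
  qed
  then have "\<not> merge_distortion (x ` {1..n}) M (induced_merge_height M (relabel (single_linkage n P) x)) > 7 * d"
    using d by (subst merge_distortion_relabel_gt_iff[OF C _ inj]) (auto simp: offdiag_def not_less)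
  then show ?thesis by simp
qed

section \<open>Measurability of the events and the union bound\<close>

section \<open>Consistency\<close>

text \<open>For injective labels the event is a finite union of conditions on index pairs, each
  involving a minimum of finitely many measurable functions. Coinciding labels break this
  description, but they form a null set and the label space is complete.\<close>

lemma distortion_event_measurable:
  assumes M: "graphon M" and f: "clustering_method f" and e: "e > 0"
  shows "distortion_event W M f n e \<in> sets (label_measure W n)"
proof (cases "n = 0")
  \<comment> \<open>\<open>clustering_method\<close> speaks only of \<open>n \<ge> 1\<close>;
    without nodes the distortion is its default 0.\<close>
  case True
  then have "distortion_event W M f n e = {}"
    using e by (auto simp: distortion_event_def merge_distortion_def)
  then show ?thesis by simp
next
  case False
  show ?thesis
  proof (rule sets_label_measureI)
    show "distortion_event W M f n e \<subseteq> graphs n \<times> space (labels n)"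
      by (auto simp: distortion_event_def space_label_measure)
    fix G assume G: "G \<in> graphs n"
    have C: "clustering {1..n} (f n G)"
      using f False G by (simp add: clustering_method_def)
    let ?h = "\<lambda>i j x. \<bar>M (x i) (x j) - Min ((\<lambda>(u, v). M (x u) (x v)) ` offdiag (smallest_cluster (f n G) i j))\<bar>"
    have "?h i j \<in> borel_measurable (labels n)" if "(i, j) \<in> offdiag {1..n}" for i j
    proof -
      have ij: "i \<in> {1..n}" "j \<in> {1..n}" "i \<noteq> j" using that by (auto simp: offdiag_def)
      let ?D = "smallest_cluster (f n G) i j"
      have D: "?D \<subseteq> {1..n}"
        using smallest_cluster(1)[OF C finite_atLeastAtMost ij(1,2)] C by (auto simp: clustering_def)
      have "(\<lambda>x. Min ((\<lambda>p. M (x (fst p)) (x (snd p))) ` offdiag ?D)) \<in> borel_measurable (labels n)"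
      proof (rule borel_measurable_Min)
        show "finite (offdiag ?D)"
          using D by (intro finite_offdiag) (rule finite_subset, auto)
        show "(\<lambda>x. M (x (fst p)) (x (snd p))) \<in> borel_measurable (labels n)" if "p \<in> offdiag ?D" for p
          using that D by (intro borel_measurable_label_pair_graphon[OF M]) (auto simp: offdiag_def)
      qed
      then show ?thesis
        using borel_measurable_label_pair_graphon[OF M ij] by (simp add: case_prod_unfold)
    qed
    then have "{x \<in> space (labels n). ?h (fst p) (snd p) x > e} \<in> sets (labels n)" if "p \<in> offdiag {1..n}" for p
      using that by (intro borel_measurable_less) auto
    then have meas: "(\<Union>p\<in>offdiag {1..n}. {x \<in> space (labels n). ?h (fst p) (snd p) x > e}) \<in> sets (labels n)"
      by (intro sets.finite_UN) (auto simp: finite_offdiag)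
    have inj: "AE x in labels n. inj_on x {1..n}"
      unfolding labels_def by (rule AE_labels_inj) simp
    have "AE x in labels n. x \<in> (\<Union>p\<in>offdiag {1..n}. {x \<in> space (labels n). ?h (fst p) (snd p) x > e}) \<longleftrightarrow>
        x \<in> {x \<in> space (labels n). (G, x) \<in> distortion_event W M f n e}"
      using inj
    proof eventually_elim
      case (elim x)
      have "(G, x) \<in> distortion_event W M f n e \<longleftrightarrow> x \<in> space (labels n) \<and> (\<exists>p\<in>offdiag {1..n}. ?h (fst p) (snd p) x > e)"
        using G merge_distortion_relabel_gt_iff[OF C finite_atLeastAtMost elim, of e M] e
        by (auto simp: distortion_event_def space_label_measure case_prod_unfold)
      then show ?case by blast
    qed
    from completion.in_sets_AE[OF this[unfolded labels_def]] meas
    show "{x \<in> space (labels n). (G, x) \<in> distortion_event W M f n e} \<in> sets (labels n)"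
      unfolding labels_def by blast
  qed
qed

text \<open>Since \<open>measure\<close> is 0 on nonmeasurable sets, this fact is what makes the
  consistency hypothesis a bound on an actual probability.\<close>

lemma max_norm_event_measurable:
  fixes Phat :: "nat \<Rightarrow> nat set set \<Rightarrow> nat \<Rightarrow> nat \<Rightarrow> real"
  assumes W: "graphon W" and e: "e > 0"
  shows "{(G, x) \<in> space (label_measure W n).
           Max (insert 0 {\<bar>W (x i) (x j) - Phat n G i j\<bar> | i j.
             i \<in> {1..n} \<and> j \<in> {1..n} \<and> i \<noteq> j}) > e} \<in> sets (label_measure W n)"
proof (rule sets_label_measureI)
  fix G assume G: "G \<in> graphs n"
  have "{x \<in> space (labels n). \<bar>W (x (fst p)) (x (snd p)) - Phat n G (fst p) (snd p)\<bar> > e} \<in> sets (labels n)"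
    if "p \<in> offdiag {1..n}" for p
    using borel_measurable_label_pair_graphon[OF W, of "fst p" n "snd p"] that
    by (intro borel_measurable_less) (auto simp: offdiag_def)
  then have "(\<Union>p\<in>offdiag {1..n}. {x \<in> space (labels n).
      \<bar>W (x (fst p)) (x (snd p)) - Phat n G (fst p) (snd p)\<bar> > e}) \<in> sets (labels n)"
    by (intro sets.finite_UN) (auto simp: finite_offdiag)
  also have "(\<Union>p\<in>offdiag {1..n}. {x \<in> space (labels n).
      \<bar>W (x (fst p)) (x (snd p)) - Phat n G (fst p) (snd p)\<bar> > e}) =
      {x \<in> space (labels n). (G, x) \<in> {(G, x) \<in> space (label_measure W n).
           Max (insert 0 {\<bar>W (x i) (x j) - Phat n G i j\<bar> | i j.
             i \<in> {1..n} \<and> j \<in> {1..n} \<and> i \<noteq> j}) > e}}"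
    using G unfolding Max_offdiag_gt_iff[OF finite_atLeastAtMost less_imp_le[OF e]]
    by (auto simp: space_label_measure case_prod_unfold)
  finally show "{x \<in> space (labels n). (G, x) \<in> {(G, x) \<in> space (label_measure W n).
           Max (insert 0 {\<bar>W (x i) (x j) - Phat n G i j\<bar> | i j.
             i \<in> {1..n} \<and> j \<in> {1..n} \<and> i \<noteq> j}) > e}} \<in> sets (labels n)" .
qed (auto simp: space_label_measure)

theorem theorem1:
  fixes W :: "real \<Rightarrow> real \<Rightarrow> real" and c :: real
    and Phat :: "nat \<Rightarrow> nat set set \<Rightarrow> nat \<Rightarrow> nat \<Rightarrow> real"
    and f :: "nat \<Rightarrow> nat set set \<Rightarrow> nat set set"
  assumes "graphon W"
    and "piecewise_lipschitz c W"
    and "matrix_estimator Phat"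
    and "max_norm_consistent W Phat"
    and "\<And>n G. G \<in> graphs n \<Longrightarrow> f n G = single_linkage n (Phat n G)"
  shows "consistent_cluster_tree_estimator W f"
  unfolding consistent_cluster_tree_estimator_def
proof (intro conjI allI impI)
  note W = assms(1)
  have sym: "Phat n G i j = Phat n G j i" if "G \<in> graphs n" "i \<in> {1..n}" "j \<in> {1..n}" for n G i j
    using assms(3) that by (simp add: matrix_estimator_def)
  show f: "clustering_method f"
    unfolding clustering_method_def using assms(5) clustering_single_linkage sym by metis
  fix M and e :: real assume M: "mergeon W M" and e: "e > 0"
  have Mg: "graphon M" using M by (simp add: mergeon_def)
  show meas: "distortion_event W M f n e \<in> sets (label_measure W n)" for n
    by (rule distortion_event_measurable[OF Mg f e])
  \<comment> \<open>The deterministic estimate loses \<open>7 * d\<close>, so the distortion is at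
    most \<open>e\<close> off the bad events.\<close>
  define d where "d = e / 7"
  have d: "d > 0" and de: "7 * d = e" using e by (auto simp: d_def)
  obtain \<Q> where \<Q>: "fine_partition W d \<Q>"
    using piecewise_lipschitz_fine_partition[OF assms(2) d] by blast
  have fin: "finite \<Q>" and ev: "\<And>Q. Q \<in> \<Q> \<Longrightarrow> Q \<in> sets unit_leb" and pos: "\<And>Q. Q \<in> \<Q> \<Longrightarrow> measure unit_leb Q > 0"
    using \<Q> by (auto simp: fine_partition_def)
  define B where "B n = {(G, x) \<in> space (label_measure W n).
           Max (insert 0 {\<bar>W (x i) (x j) - Phat n G i j\<bar> | i j.
             i \<in> {1..n} \<and> j \<in> {1..n} \<and> i \<noteq> j}) > d}" for n
  define H where "H Q n = {(G, x) \<in> space (label_measure W n). \<forall>i\<in>{1..n}. x i \<notin> Q}" for Q n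
  have B_meas: "B n \<in> sets (label_measure W n)" for n
    unfolding B_def by (rule max_norm_event_measurable[OF W d])
  have H_meas: "H Q n \<in> sets (label_measure W n)" if "Q \<in> \<Q>" for Q n
    unfolding H_def by (rule measure_no_label_in(1)[OF W ev[OF that]])
  have H: "measure (label_measure W n) (H Q n) = (1 - measure unit_leb Q) ^ n" if "Q \<in> \<Q>" for Q n
    unfolding H_def by (rule measure_no_label_in(2)[OF W ev[OF that]])
  \<comment> \<open>Up to a null set, a large distortion forces an inaccurate estimate or a part
    without labels. The number of summands is independent of \<open>n\<close>, so the limit can be
    taken term by term.\<close>
  have bound: "measure (label_measure W n) (distortion_event W M f n e)
      \<le> measure (label_measure W n) (B n) + (\<Sum>Q\<in>\<Q>. (1 - measure unit_leb Q) ^ n)" if n: "n \<ge> 1" for n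
  proof -
    interpret prob_space "label_measure W n" by (rule prob_space_label_measure[OF W])
    have UH: "(\<Union>Q\<in>\<Q>. H Q n) \<in> events"
      using fin H_meas by auto
    have "AE (G, x) in label_measure W n. typical_labels W M d \<Q> n x"
      by (rule AE_label_measure[OF W AE_typical_labels[OF W M \<Q> d]])
    then have "AE p in label_measure W n. p \<in> distortion_event W M f n e \<longrightarrow> p \<in> B n \<union> (\<Union>Q\<in>\<Q>. H Q n)"
      using AE_space
    proof eventually_elim
      case (elim p)
      obtain G x where p: "p = (G, x)" by (cases p)
      have G: "G \<in> graphs n" and x: "x \<in> space (labels n)"
        using elim(2) by (auto simp: p space_label_measure)
      have typical: "typical_labels W M d \<Q> n x" using elim(1) by (simp add: p)
      have "p \<notin> distortion_event W M f n e" if nB: "p \<notin> B n" and nH: "p \<notin> (\<Union>Q\<in>\<Q>. H Q n)"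
      proof -
        have hit: "\<exists>i\<in>{1..n}. x i \<in> Q" if "Q \<in> \<Q>" for Q
          using nH elim(2) that unfolding H_def p by blast
        have "\<not> Max (insert 0 {\<bar>W (x i) (x j) - Phat n G i j\<bar> | i j.
             i \<in> {1..n} \<and> j \<in> {1..n} \<and> i \<noteq> j}) > d"
          using nB elim(2) unfolding B_def p by blast
        then have close: "\<bar>W (x i) (x j) - Phat n G i j\<bar> \<le> d" if "i \<in> {1..n}" "j \<in> {1..n}" "i \<noteq> j" for i j
          using d that by (subst (asm) Max_offdiag_gt_iff) (auto simp: offdiag_def not_less)
        have "merge_distortion (x ` {1..n}) M (induced_merge_height M (relabel (single_linkage n (Phat n G)) x)) \<le> 7 * d"
          by (rule typical_labels_distortion[OF W Mg \<Q> d x typical hit close sym[OF G] n])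
        then show ?thesis
          unfolding distortion_event_def p using assms(5)[OF G] de by simp
      qed
      then show ?case by blast
    qed
    then have "prob (distortion_event W M f n e) \<le> prob (B n \<union> (\<Union>Q\<in>\<Q>. H Q n))"
      using B_meas UH by (intro finite_measure_mono_AE) auto
    also have "\<dots> \<le> prob (B n) + prob (\<Union>Q\<in>\<Q>. H Q n)"
      using B_meas UH by (rule measure_Un_le)
    also have "prob (\<Union>Q\<in>\<Q>. H Q n) \<le> (\<Sum>Q\<in>\<Q>. prob (H Q n))"
      using fin H_meas by (intro finite_measure_subadditive_finite) auto
    finally show ?thesis using H by simp
  qed
  have "(\<lambda>n. measure (label_measure W n) (B n)) \<longlonglongrightarrow> 0"
    using assms(4) d unfolding max_norm_consistent_def B_def by blast
  moreover have "(\<lambda>n. (1 - measure unit_leb Q) ^ n) \<longlonglongrightarrow> 0" if "Q \<in> \<Q>" for Q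
  proof (rule LIMSEQ_realpow_zero)
    show "0 \<le> 1 - measure unit_leb Q" "1 - measure unit_leb Q < 1"
      using prob_space.prob_le_1[OF prob_space_unit_leb, of Q] pos[OF that] by auto
  qed
  ultimately have "(\<lambda>n. measure (label_measure W n) (B n) + (\<Sum>Q\<in>\<Q>. (1 - measure unit_leb Q) ^ n)) \<longlonglongrightarrow> 0"
    by (intro tendsto_add_zero tendsto_null_sum)
  then show "(\<lambda>n. measure (label_measure W n) (distortion_event W M f n e)) \<longlonglongrightarrow> 0"
  proof (rule Lim_null_comparison[rotated])
    show "\<forall>\<^sub>F n in sequentially. norm (measure (label_measure W n) (distortion_event W M f n e))
        \<le> measure (label_measure W n) (B n) + (\<Sum>Q\<in>\<Q>. (1 - measure unit_leb Q) ^ n)"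
      using eventually_ge_at_top[of 1] by eventually_elim (use bound in simp)
  qed
qed

end
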